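(* Let $s$ be a step sequence over a g-comtrace alphabet $(E,sim,ser,inl)$. Then $G^{\{s\}}=G_{[s]}$, where $G_{[s]}=\big(\Sigma_s,\bigcap_{u\in[s]}(\lhd_u)^{\mathrm{sym}},\bigcap_{u\in[s]}\lhd_u^\frown\big)$.
   Context: Relations: for $R$ on $X$, $R^{-1}$ inverse, $R^*=\bigcup_{i\ge0}R^i$ ($R^0=\mathrm{id}_X$), $R\circ S=\{(x,y):\exists z.\,xRz\wedge zSy\}$, $R^{\mathrm{sym}}=R\cup R^{-1}$, $R^{\Cap}=R\cap R^{-1}$, $R^C=(X\times X)\setminus R$. A g-comtrace alphabet is $(E,sim,ser,inl)$ with $E$ finite, $sim,inl\subseteq E\times E$ irreflexive and symmetric, $ser\subseteq sim$, $sim\cap inl=\emptyset$. Steps $\mathbb{S}$: nonempty $A\subseteq E$ with $(a,b)\in sim$ for all distinct $a,b\in A$; step sequences: elements of $\mathbb{S}^*$. $\equiv$ is the reflexive symmetric transitive closure of the pairs $(wAz,wBCz)$ ($A,B,C\in\mathbb{S}$, $A=B\cup C$, $B\times C\subseteq ser$) and $(wABz,wBAz)$ ($A,B\in\mathbb{S}$, $A\times B\subseteq inl$); $[s]$ is the class of $s$. For $s=A_1\dots A_k$: $\overline{A_i}=\{e^{(m+1)}:e\in A_i\}$ where $m$ is the number of $j<i$ with $e\in A_j$; $\Sigma_s=\bigcup_i\overline{A_i}$ (equal for congruent sequences); $l(e^{(j)})=e$; $pos_s(\alpha)=i$ iff $\alpha\in\overline{A_i}$; $\alpha\lhd_s\beta$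 iff $pos_s(\alpha)<pos_s(\beta)$; $\alpha\lhd_s^\frown\beta$ iff $\alpha\ne\beta\wedge pos_s(\alpha)\le pos_s(\beta)$. Closures: $(X,R_1,R_2)^\lozenge=(X,\prec_{R_1,R_2},\sqsubset_{R_1,R_2})$ with $\prec_{R_1,R_2}=(R_1\cup R_2)^*\circ R_1\circ(R_1\cup R_2)^*$, $\sqsubset_{R_1,R_2}=(R_1\cup R_2)^*\setminus\mathrm{id}_X$; for $R_3=R_1\cap R_2^*$, $(X,R_1,R_2)^{\bowtie}=(X,(\prec_{R_3,R_2})^{\mathrm{sym}}\cup R_1,\sqsubset_{R_3,R_2})$. On $\Sigma_s$: $\alpha<\!\!>_s\beta$ iff $(l(\alpha),l(\beta))\in inl$; $\alpha\sqsubset_s\beta$ iff $\alpha\lhd_s^\frown\beta$ and $(l(\beta),l(\alpha))\notin ser\cup inl$; $\alpha\prec_s\beta$ iff $\alpha\lhd_s\beta$ and one of: (i) $(l(\alpha),l(\beta))\notin ser\cup inl$; (ii) $(\alpha,\beta)\in<\!\!>_s\cap((\sqsubset_s^* )^{\Cap}\circ(<\!\!>_s)^C\circ(\sqsubset_s^* )^{\Cap})$; (iii) $(l(\alpha),l(\beta))\in ser$ and there are $\delta,\gamma\in\Sigma_s$ with $\delta\lhd_s\gamma$, $(l(\delta),l(\gamma))\notin ser$, $\alpha\sqsubset_s^*\delta\sqsubset_s^*\beta$, $\alpha\sqsubset_s^*\gamma\sqsubset_s^*\beta$. $G^{\{s\}}=(\Sigma_s,\prec_s\cup<\!\!>_s,\prec_s\cup\sqsubset_s)^{\bowtie}$.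 *)

theory Defs
  imports Main
begin

section \<open>Relations on a carrier\<close>

definition star_on :: "'b set \<Rightarrow> 'b rel \<Rightarrow> 'b rel" where
  \<comment> \<open>the union of the powers \<open>R\<^sup>i\<close>, \<open>i \<ge> 0\<close>, where \<open>R\<^sup>0\<close> is the identity on \<open>X\<close> only;
    \<open>rtrancl\<close> would add the identity on the whole type\<close>
  "star_on X R = Id_on X \<union> R\<^sup>+"

definition rel_sym :: "'b rel \<Rightarrow> 'b rel" where
  "rel_sym R = R \<union> R\<inverse>"

definition rel_mutual :: "'b rel \<Rightarrow> 'b rel" where
  "rel_mutual R = R \<inter> R\<inverse>"

definition rel_compl :: "'b set \<Rightarrow> 'b rel \<Rightarrow> 'b rel" where
  "rel_compl X R = X \<times> X - R"


section \<open>Relational structures and their closure\<close>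

type_synonym 'b rel_structure = "'b set \<times> 'b rel \<times> 'b rel"

definition closure_prec :: "'b set \<Rightarrow> 'b rel \<Rightarrow> 'b rel \<Rightarrow> 'b rel" where
  "closure_prec X R1 R2 = star_on X (R1 \<union> R2) O R1 O star_on X (R1 \<union> R2)"

definition closure_sqsubset :: "'b set \<Rightarrow> 'b rel \<Rightarrow> 'b rel \<Rightarrow> 'b rel" where
  "closure_sqsubset X R1 R2 = star_on X (R1 \<union> R2) - Id_on X"

definition bowtie_closure :: "'b rel_structure \<Rightarrow> 'b rel_structure" where
  "bowtie_closure = (\<lambda>(X, R1, R2).
     let R3 = R1 \<inter> star_on X R2
     in (X, rel_sym (closure_prec X R3 R2) \<union> R1, closure_sqsubset X R3 R2))"


section \<open>Generalised comtrace alphabets and step sequences\<close>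

definition gcomtrace_alphabet :: "'a set \<Rightarrow> 'a rel \<Rightarrow> 'a rel \<Rightarrow> 'a rel \<Rightarrow> bool" where
  "gcomtrace_alphabet E sim ser inl \<longleftrightarrow>
     finite E \<and>
     sim \<subseteq> E \<times> E \<and> irrefl sim \<and> sym sim \<and>
     inl \<subseteq> E \<times> E \<and> irrefl inl \<and> sym inl \<and>
     ser \<subseteq> sim \<and> sim \<inter> inl = {}"

definition steps :: "'a set \<Rightarrow> 'a rel \<Rightarrow> 'a set set" where
  "steps E sim =
     {A. A \<noteq> {} \<and> A \<subseteq> E \<and> (\<forall>a\<in>A. \<forall>b\<in>A. a \<noteq> b \<longrightarrow> (a, b) \<in> sim)}"

abbreviation step_sequences :: "'a set \<Rightarrow> 'a rel \<Rightarrow> 'a set list set" where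
  "step_sequences E sim \<equiv> lists (steps E sim)"

definition seq_rewrite :: "'a set \<Rightarrow> 'a rel \<Rightarrow> 'a rel \<Rightarrow> 'a set list rel" where
  "seq_rewrite E sim ser =
     {(w @ [A] @ z, w @ [B, C] @ z) | w z A B C.
        w \<in> step_sequences E sim \<and> z \<in> step_sequences E sim \<and>
        A \<in> steps E sim \<and> B \<in> steps E sim \<and> C \<in> steps E sim \<and>
        A = B \<union> C \<and> B \<times> C \<subseteq> ser}"

definition inl_rewrite :: "'a set \<Rightarrow> 'a rel \<Rightarrow> 'a rel \<Rightarrow> 'a set list rel" where
  "inl_rewrite E sim inl =
     {(w @ [A, B] @ z, w @ [B, A] @ z) | w z A B.
        w \<in> step_sequences E sim \<and> z \<in> step_sequences E sim \<and>
        A \<in> steps E sim \<and> B \<in> steps E sim \<and> A \<times> B \<subseteq> inl}"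

definition step_equiv :: "'a set \<Rightarrow> 'a rel \<Rightarrow> 'a rel \<Rightarrow> 'a rel \<Rightarrow> 'a set list rel" where
  "step_equiv E sim ser inl =
     star_on (step_sequences E sim)
       (rel_sym (seq_rewrite E sim ser \<union> inl_rewrite E sim inl))"

definition gcomtrace ::
  "'a set \<Rightarrow> 'a rel \<Rightarrow> 'a rel \<Rightarrow> 'a rel \<Rightarrow> 'a set list \<Rightarrow> 'a set list set" where
  "gcomtrace E sim ser inl s = step_equiv E sim ser inl `` {s}"


section \<open>Event occurrences\<close>

type_synonym 'a occ = "'a \<times> nat"
  \<comment> \<open>\<open>(e, j)\<close> is the occurrence \<open>e\<^sup>(\<^sup>j\<^sup>)\<close>, numbered from \<open>1\<close>; its label \<open>l\<close> is \<open>fst\<close>\<close>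

definition occ_step :: "'a set list \<Rightarrow> nat \<Rightarrow> 'a occ set" where
  "occ_step s i = {(e, card {j. j < i \<and> e \<in> s ! j} + 1) | e. e \<in> s ! i}"

definition occs :: "'a set list \<Rightarrow> 'a occ set" where
  "occs s = (\<Union>i<length s. occ_step s i)"

definition pos :: "'a set list \<Rightarrow> 'a occ \<Rightarrow> nat" where
  \<comment> \<open>0-based, like list indexing; the position is unique for \<open>\<alpha> \<in> occs s\<close>
    and unspecified otherwise\<close>
  "pos s \<alpha> = (THE i. i < length s \<and> \<alpha> \<in> occ_step s i)"

definition before :: "'a set list \<Rightarrow> 'a occ rel" where
  "before s = {(\<alpha>, \<beta>) \<in> occs s \<times> occs s. pos s \<alpha> < pos s \<beta>}"

definition not_after :: "'a set list \<Rightarrow> 'a occ rel" where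
  "not_after s = {(\<alpha>, \<beta>) \<in> occs s \<times> occs s. \<alpha> \<noteq> \<beta> \<and> pos s \<alpha> \<le> pos s \<beta>}"


section \<open>The structure of a g-comtrace\<close>

definition trace_structure ::
  "'a set \<Rightarrow> 'a rel \<Rightarrow> 'a rel \<Rightarrow> 'a rel \<Rightarrow> 'a set list \<Rightarrow> 'a occ rel_structure" where
  \<comment> \<open>uses the carrier \<open>occs s\<close> of the representative \<open>s\<close>; equivalent step
    sequences have the same occurrences\<close>
  "trace_structure E sim ser inl s =
     (occs s,
      \<Inter>u\<in>gcomtrace E sim ser inl s. rel_sym (before u),
      \<Inter>u\<in>gcomtrace E sim ser inl s. not_after u)"


section \<open>The structure defined from a single step sequence\<close>

definition occ_inl :: "'a rel \<Rightarrow> 'a set list \<Rightarrow> 'a occ rel" where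
  "occ_inl inl s = {(\<alpha>, \<beta>) \<in> occs s \<times> occs s. (fst \<alpha>, fst \<beta>) \<in> inl}"

definition occ_sqsubset :: "'a rel \<Rightarrow> 'a rel \<Rightarrow> 'a set list \<Rightarrow> 'a occ rel" where
  "occ_sqsubset ser inl s =
     {(\<alpha>, \<beta>) \<in> not_after s. (fst \<beta>, fst \<alpha>) \<notin> ser \<union> inl}"

definition occ_prec :: "'a rel \<Rightarrow> 'a rel \<Rightarrow> 'a set list \<Rightarrow> 'a occ rel" where
  "occ_prec ser inl s =
     (let sq = star_on (occs s) (occ_sqsubset ser inl s) in
      {(\<alpha>, \<beta>) \<in> before s.
         (fst \<alpha>, fst \<beta>) \<notin> ser \<union> inl \<or>
         (\<alpha>, \<beta>) \<in> occ_inl inl s \<inter>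
           (rel_mutual sq O rel_compl (occs s) (occ_inl inl s) O rel_mutual sq) \<or>
         ((fst \<alpha>, fst \<beta>) \<in> ser \<and>
          (\<exists>\<delta>\<in>occs s. \<exists>\<gamma>\<in>occs s.
             (\<delta>, \<gamma>) \<in> before s \<and> (fst \<delta>, fst \<gamma>) \<notin> ser \<and>
             (\<alpha>, \<delta>) \<in> sq \<and> (\<delta>, \<beta>) \<in> sq \<and> (\<alpha>, \<gamma>) \<in> sq \<and> (\<gamma>, \<beta>) \<in> sq))})"

definition seq_structure ::
  "'a rel \<Rightarrow> 'a rel \<Rightarrow> 'a set list \<Rightarrow> 'a occ rel_structure" where
  "seq_structure ser inl s =
     bowtie_closure
       (occs s,
        occ_prec ser inl s \<union> occ_inl inl s,
        occ_prec ser inl s \<union> occ_sqsubset ser inl s)"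

end

theory Submission
  imports Defs
begin

text \<open>
  Lift step sequences to sequences of disjoint sets of occurrences, on which the two rewriting rules
  act as splitting a step, fusing two steps and swapping two steps. A single rewriting changes the
  order of two occurrences only if their labels are related by \<open>ser\<close> or \<open>inl\<close>, and from this one
  checks that \<open>\<sqsubset>\<^sub>s\<close> and \<open>\<prec>\<^sub>s\<close> depend on the class \<open>[s]\<close> only; hence every relation in \<open>G\<^bsup>{s}\<^esup>\<close>
  holds in all \<open>u \<in> [s]\<close>.

  For the converse, replace \<open>s\<close> by a longest member of \<open>[s]\<close>: each of its steps is then strongly
  connected for \<open>\<sqsubset>\<^sub>s\<close>, because otherwise it could be split. Let \<open>K = (\<prec>\<^sub>s \<union> \<sqsubset>\<^sub>s)\<^sup>*\<close>. Two consecutive such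
  steps that are not related by \<open>\<prec>\<^sub>s \<union> \<sqsubset>\<^sub>s\<close> can be swapped, since the labels of their elements are
  either all in \<open>inl\<close> or all in \<open>ser\<close> in both directions (clause (ii) of \<open>\<prec>\<^sub>s\<close> excludes mixed cases).
  So every \<open>K\<close>-down-set can be executed first, and if \<open>\<alpha> K \<beta>\<close> fails then executing the down-set
  of \<open>\<beta>\<close> first puts \<open>\<beta>\<close> before \<open>\<alpha>\<close>. If \<open>\<alpha>\<close>, \<open>\<beta>\<close> are not forced to be at different positions, let \<open>I\<close>
  be the \<open>K\<close>-interval from \<open>\<alpha>\<close> to \<open>\<beta>\<close> or, if they are incomparable, the union of the steps of \<open>\<alpha>\<close>
  and \<open>\<beta>\<close>. It is \<open>K\<close>-convex, so it can be made contiguous, and by clauses (i) and (iii) earlier elements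
  of \<open>I\<close> are \<open>ser\<close>-related to later ones, so it can be fused to one step.
\<close>

section \<open>Sequences of sets of occurrences\<close>

text \<open>\<open>c e\<close> is the number of occurrences of \<open>e\<close> that precede the sequence.\<close>

primrec occ_list :: "('a \<Rightarrow> nat) \<Rightarrow> 'a set list \<Rightarrow> 'a occ set list" where
  "occ_list c [] = []"
| "occ_list c (A # s) =
     (\<lambda>e. (e, Suc (c e))) ` A # occ_list (\<lambda>e. if e \<in> A then Suc (c e) else c e) s"

abbreviation occ_seq :: "'a set list \<Rightarrow> 'a occ set list" where
  "occ_seq \<equiv> occ_list (\<lambda>_. 0)"

abbreviation tally :: "('a \<Rightarrow> nat) \<Rightarrow> 'a set list \<Rightarrow> 'a \<Rightarrow> nat" where
  "tally c w \<equiv> \<lambda>e. c e + length (filter (\<lambda>A. e \<in> A) w)"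

lemma length_occ_list [simp]: "length (occ_list c s) = length s"
  by (induction s arbitrary: c) auto

lemma occ_list_append:
  "occ_list c (w @ z) = occ_list c w @ occ_list (tally c w) z"
proof (induction w arbitrary: c)
  case (Cons A w)
  have "(\<lambda>e. (if e \<in> A then Suc (c e) else c e) + length (filter (\<lambda>A. e \<in> A) w))
      = tally c (A # w)" by auto
  then show ?case by (simp only: append_Cons occ_list.simps Cons.IH)
qed simp

text \<open>Consequently \<open>occ_list c\<close> is injective, and an equation for
  \<open>occ_seq u\<close> determines \<open>u\<close>.\<close>

lemma map_fst_occ_list [simp]: "map ((`) fst) (occ_list c s) = s"
  by (induction s arbitrary: c) (auto simp: image_image)

lemma nth_occ_list:
  "i < length s \<Longrightarrow>
   occ_list c s ! i = (\<lambda>e. (e, Suc (tally c (take i s) e))) ` (s ! i)"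
proof (induction s arbitrary: c i)
  case (Cons A s)
  show ?case
  proof (cases i)
    case (Suc k)
    with Cons.prems have k: "k < length s" by simp
    show ?thesis using Cons.IH[OF k] Suc by (auto intro!: image_cong)
  qed simp
qed simp

lemma occ_step_eq_nth: "i < length s \<Longrightarrow> occ_step s i = occ_seq s ! i"
proof -
  assume i: "i < length s"
  have card: "card {j. j < i \<and> e \<in> s ! j} = length (filter (\<lambda>A. e \<in> A) (take i s))" for e
    using i by (auto simp: length_filter_conv_card intro!: arg_cong[where f = card])
  show "occ_step s i = occ_seq s ! i"
    using i by (auto simp: occ_step_def nth_occ_list card)
qed

lemma occs_eq_Union: "occs s = \<Union> (set (occ_seq s))"
  unfolding occs_def by (auto simp: occ_step_eq_nth set_conv_nth Bex_def)

text \<open>Counters never decrease, so a number already given to a label is not given to it again.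
  This yields the disjointness of the steps.\<close>

lemma occ_list_gt: "\<alpha> \<in> \<Union> (set (occ_list c s)) \<Longrightarrow> c (fst \<alpha>) < snd \<alpha>"
  by (induction s arbitrary: c) (force split: if_splits)+

section \<open>Order and disjointness in lists of sets\<close>

primrec list_before :: "'b set list \<Rightarrow> 'b rel" where
  "list_before [] = {}"
| "list_before (A # T) = A \<times> \<Union> (set T) \<union> list_before T"

primrec disjoint_steps :: "'b set list \<Rightarrow> bool" where
  "disjoint_steps [] \<longleftrightarrow> True"
| "disjoint_steps (A # T) \<longleftrightarrow> A \<inter> \<Union> (set T) = {} \<and> disjoint_steps T"

lemma list_before_append:
  "list_before (T @ U) = list_before T \<union> list_before U \<union> \<Union> (set T) \<times> \<Union> (set U)"
  by (induction T) auto

lemma disjoint_steps_append: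
  "disjoint_steps (T @ U) \<longleftrightarrow>
   disjoint_steps T \<and> disjoint_steps U \<and> \<Union> (set T) \<inter> \<Union> (set U) = {}"
  by (induction T) auto

lemma list_before_subset: "list_before T \<subseteq> \<Union> (set T) \<times> \<Union> (set T)"
  by (induction T) auto

lemma disjoint_steps_occ_list: "disjoint_steps (occ_list c s)"
proof (induction s arbitrary: c)
  case (Cons A s)
  then show ?case
    using occ_list_gt[of _ "\<lambda>e. if e \<in> A then Suc (c e) else c e" s] by fastforce
qed simp

lemma disjoint_steps_nth_eq:
  "disjoint_steps T \<Longrightarrow> i < length T \<Longrightarrow> j < length T \<Longrightarrow>
   \<alpha> \<in> T ! i \<Longrightarrow> \<alpha> \<in> T ! j \<Longrightarrow> i = j"
proof (induction T arbitrary: i j)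
  case (Cons A T)
  have tail: "\<alpha> \<in> \<Union> (set T)" if "\<alpha> \<in> T ! k" "k < length T" for k
    using that nth_mem by blast
  show ?case
    using Cons.prems Cons.IH tail by (cases i; cases j) auto
qed simp

lemma pos_eq:
  assumes "i < length s" "\<alpha> \<in> occ_seq s ! i"
  shows "pos s \<alpha> = i"
  unfolding pos_def
proof (rule the_equality)
  show "i < length s \<and> \<alpha> \<in> occ_step s i" using assms by (simp add: occ_step_eq_nth)
next
  fix j assume j: "j < length s \<and> \<alpha> \<in> occ_step s j"
  with assms show "j = i"
    using disjoint_steps_nth_eq[OF disjoint_steps_occ_list, where i = j and j = i]
    by (metis length_occ_list occ_step_eq_nth)
qed

lemma list_before_iff_nth:
  "(\<alpha>, \<beta>) \<in> list_before T \<longleftrightarrow>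
   (\<exists>j<length T. \<exists>i<j. \<alpha> \<in> T ! i \<and> \<beta> \<in> T ! j)"
proof (induction T)
  case (Cons A T)
  have "(\<exists>j<length (A # T). \<exists>i<j. \<alpha> \<in> (A # T) ! i \<and> \<beta> \<in> (A # T) ! j)
     \<longleftrightarrow> \<alpha> \<in> A \<and> (\<exists>j<length T. \<beta> \<in> T ! j) \<or> (\<exists>j<length T. \<exists>i<j. \<alpha> \<in> T ! i \<and> \<beta> \<in> T ! j)"
    by (simp add: Ex_less_Suc2) blast
  then show ?case using Cons by (auto simp: set_conv_nth)
qed simp

lemma occs_nthE:
  assumes "\<alpha> \<in> occs s"
  obtains "pos s \<alpha> < length s" "\<alpha> \<in> occ_seq s ! pos s \<alpha>"
  using assms pos_eq[of _ s \<alpha>] by (auto simp: occs_eq_Union set_conv_nth)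

text \<open>On a concatenation \<open>list_before\<close> is plain set algebra, and a rewriting
  changes one segment of a concatenation. Positions can thus be left aside when orders are
  compared.\<close>

lemma before_eq: "before s = list_before (occ_seq s)"
proof -
  have "(\<alpha>, \<beta>) \<in> before s \<longleftrightarrow> (\<alpha>, \<beta>) \<in> list_before (occ_seq s)" for \<alpha> \<beta>
  proof
    assume "(\<alpha>, \<beta>) \<in> before s"
    then have "\<alpha> \<in> occs s" "\<beta> \<in> occs s" "pos s \<alpha> < pos s \<beta>" by (auto simp: before_def)
    then show "(\<alpha>, \<beta>) \<in> list_before (occ_seq s)"
      unfolding list_before_iff_nth by (metis occs_nthE length_occ_list)
  next
    assume *: "(\<alpha>, \<beta>) \<in> list_before (occ_seq s)"
    then obtain i j where "j < length s" "i < j" "\<alpha> \<in> occ_seq s ! i" "\<beta> \<in> occ_seq s ! j"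
      by (auto simp: list_before_iff_nth)
    then have "pos s \<alpha> < pos s \<beta>"
      using pos_eq[of i s \<alpha>] pos_eq[of j s \<beta>] by simp
    then show "(\<alpha>, \<beta>) \<in> before s"
      using * list_before_subset[of "occ_seq s"] by (auto simp: before_def occs_eq_Union)
  qed
  then show ?thesis by auto
qed

text \<open>With this form only the effect of a rewriting on \<open>before\<close> has to be
  determined.\<close>

lemma not_after_eq:
  "not_after s = {(\<alpha>, \<beta>) \<in> occs s \<times> occs s. \<alpha> \<noteq> \<beta> \<and> (\<beta>, \<alpha>) \<notin> before s}"
  by (auto simp: not_after_def before_def)

lemma same_step_iff:
  assumes "A \<in> set (occ_seq s)" "\<alpha> \<in> A" "\<beta> \<in> occs s"
  shows "\<beta> \<in> A \<longleftrightarrow> pos s \<beta> = pos s \<alpha>"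
proof -
  obtain i where "i < length s" "A = occ_seq s ! i"
    using assms(1) by (auto simp: in_set_conv_nth)
  then show ?thesis using assms(2,3) by (metis occs_nthE pos_eq)
qed

section \<open>Numbering around a rewritten segment\<close>

abbreviation number :: "('a \<Rightarrow> nat) \<Rightarrow> 'a set \<Rightarrow> 'a occ set" where
  "number c A \<equiv> (\<lambda>e. (e, Suc (c e))) ` A"

abbreviation advance :: "('a \<Rightarrow> nat) \<Rightarrow> 'a set \<Rightarrow> 'a \<Rightarrow> nat" where
  "advance c A \<equiv> \<lambda>e. if e \<in> A then Suc (c e) else c e"

lemma occ_list_append1:
  "occ_list c (w @ [A] @ z) =
   occ_list c w @ [number (tally c w) A] @ occ_list (advance (tally c w) A) z"
  by (simp add: occ_list_append)

text \<open>As no label is shared, \<open>B\<close> gets the numbers it would get without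
  \<open>A\<close> in front, and the counter for the tail depends on \<open>A \<union> B\<close>
  only. So splitting, fusing and swapping keep the same occurrences everywhere.\<close>

lemma occ_list_append2:
  assumes "A \<inter> B = {}"
  shows "occ_list c (w @ [A, B] @ z) =
    occ_list c w @ [number (tally c w) A, number (tally c w) B] @
    occ_list (advance (tally c w) (A \<union> B)) z"
proof -
  define d where "d = tally c w"
  have 1: "advance (advance d A) B = advance d (A \<union> B)"
    using assms by (auto simp: fun_eq_iff)
  have 2: "number (advance d A) B = number d B"
    using assms by (auto intro!: image_cong)
  have "occ_list d ([A, B] @ z) =
      [number d A, number d B] @ occ_list (advance d (A \<union> B)) z"
    by (simp only: append_Cons append_Nil occ_list.simps 1 2)
  then show ?thesis by (simp only: occ_list_append d_def)
qed

text \<open>Pulls a factorisation of the occurrence sequence back to \<open>u\<close>. It is unique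
  because \<open>X\<close> and \<open>occ_list c w\<close> have the same length.\<close>

lemma occ_list_eq_append1D:
  assumes "occ_list c u = X @ [A] @ Y"
  defines "w \<equiv> map ((`) fst) X" and "z \<equiv> map ((`) fst) Y"
  shows "u = w @ [fst ` A] @ z" "X = occ_list c w" "A = number (tally c w) (fst ` A)"
    "Y = occ_list (advance (tally c w) (fst ` A)) z"
proof -
  show u: "u = w @ [fst ` A] @ z"
    using arg_cong[OF assms(1), of "map ((`) fst)"] by (simp add: w_def z_def)
  have "X @ [A] @ Y = occ_list c w @ [number (tally c w) (fst ` A)] @
      occ_list (advance (tally c w) (fst ` A)) z"
    using assms(1) unfolding u occ_list_append1 by simp
  then have "X = occ_list c w \<and> [A] @ Y = [number (tally c w) (fst ` A)] @
      occ_list (advance (tally c w) (fst ` A)) z"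
    by (subst (asm) append_eq_append_conv) (simp_all add: w_def)
  then show "X = occ_list c w" "A = number (tally c w) (fst ` A)"
    "Y = occ_list (advance (tally c w) (fst ` A)) z"
    by simp_all
qed

lemma occ_list_eq_append2D:
  assumes "occ_list c u = X @ [A, B] @ Y" "fst ` A \<inter> fst ` B = {}"
  defines "w \<equiv> map ((`) fst) X" and "z \<equiv> map ((`) fst) Y"
  shows "u = w @ [fst ` A, fst ` B] @ z" "X = occ_list c w"
    "A = number (tally c w) (fst ` A)" "B = number (tally c w) (fst ` B)"
    "Y = occ_list (advance (tally c w) (fst ` A \<union> fst ` B)) z"
proof -
  show u: "u = w @ [fst ` A, fst ` B] @ z"
    using arg_cong[OF assms(1), of "map ((`) fst)"] by (simp add: w_def z_def)
  have "X @ [A, B] @ Y = occ_list c w @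
      [number (tally c w) (fst ` A), number (tally c w) (fst ` B)] @
      occ_list (advance (tally c w) (fst ` A \<union> fst ` B)) z"
    using assms(1) unfolding u occ_list_append2[OF assms(2)] by simp
  then have "X = occ_list c w \<and> [A, B] @ Y =
      [number (tally c w) (fst ` A), number (tally c w) (fst ` B)] @
      occ_list (advance (tally c w) (fst ` A \<union> fst ` B)) z"
    by (subst (asm) append_eq_append_conv) (simp_all add: w_def)
  then show "X = occ_list c w"
    "A = number (tally c w) (fst ` A)" "B = number (tally c w) (fst ` B)"
    "Y = occ_list (advance (tally c w) (fst ` A \<union> fst ` B)) z"
    by simp_all
qed

text \<open>The number of an occurrence is a function of its label, so the parts of a numbered step
  are numbered by the same counter.\<close>

lemma subset_number: "B \<union> C = number d (fst ` (B \<union> C)) \<Longrightarrow>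
  B = number d (fst ` B) \<and> C = number d (fst ` C)"
proof -
  assume eq: "B \<union> C = number d (fst ` (B \<union> C))"
  have "\<forall>x\<in>B \<union> C. x = (fst x, Suc (d (fst x)))"
  proof
    fix x assume "x \<in> B \<union> C"
    then have "x \<in> number d (fst ` (B \<union> C))" by (subst (asm) eq)
    then show "x = (fst x, Suc (d (fst x)))" by auto
  qed
  then have "number d (fst ` B) = (\<lambda>x. x) ` B" "number d (fst ` C) = (\<lambda>x. x) ` C"
    unfolding image_image by (intro image_cong; auto)+
  then show ?thesis by simp
qed

section \<open>Rewriting at the level of occurrences\<close>

locale gcomtrace_alph =
  fixes E :: "'a set" and sim ser inl :: "'a rel"
  assumes alphabet: "gcomtrace_alphabet E sim ser inl"
begin

abbreviation "lser \<equiv> inv_image ser fst"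
abbreviation "linl \<equiv> inv_image inl fst"
abbreviation "class_of \<equiv> gcomtrace E sim ser inl"
abbreviation "rewrite_rel \<equiv> rel_sym (seq_rewrite E sim ser \<union> inl_rewrite E sim inl)"

lemma sim_symD: "(a, b) \<in> sim \<Longrightarrow> (b, a) \<in> sim"
  and inl_symD: "(a, b) \<in> inl \<Longrightarrow> (b, a) \<in> inl"
  and not_sim_refl: "(a, a) \<notin> sim"
  and not_inl_refl: "(a, a) \<notin> inl"
  and ser_simD: "(a, b) \<in> ser \<Longrightarrow> (a, b) \<in> sim"
  and not_sim_inl: "(a, b) \<in> sim \<Longrightarrow> (a, b) \<notin> inl"
  using alphabet by (auto simp: gcomtrace_alphabet_def irrefl_def dest: symD)

lemma not_ser_refl: "(a, a) \<notin> ser"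
  using ser_simD not_sim_refl by blast

lemma steps_Un:
  assumes "A \<in> steps E sim" "B \<in> steps E sim" "A \<times> B \<subseteq> ser"
  shows "A \<union> B \<in> steps E sim"
proof -
  have "(a, b) \<in> sim" "(b, a) \<in> sim" if "a \<in> A" "b \<in> B" for a b
    using that assms(3) ser_simD sim_symD by blast+
  then show ?thesis using assms(1,2) by (auto simp: steps_def)
qed

text \<open>Irreflexivity of \<open>ser\<close> makes \<open>B\<close> and \<open>C\<close>
  disjoint, so that \<open>occ_list_append2\<close> applies.\<close>

lemma seq_rewriteE:
  assumes "(s, t) \<in> seq_rewrite E sim ser"
  obtains X Y B C where "occ_seq s = X @ [B \<union> C] @ Y" "occ_seq t = X @ [B, C] @ Y"
    "B \<times> C \<subseteq> lser"
proof -
  from assms obtain w z B C where *: "s = w @ [B \<union> C] @ z" "t = w @ [B, C] @ z"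
    "B \<times> C \<subseteq> ser"
    by (auto simp: seq_rewrite_def)
  let ?n = "number (tally (\<lambda>_. 0) w)"
  have "B \<inter> C = {}" using *(3) not_ser_refl by blast
  note occ_list_append2[OF this, of "\<lambda>_. 0" w z, folded *(2)]
  moreover note occ_list_append1[of "\<lambda>_. 0" w "B \<union> C" z, folded *(1)]
  moreover have "?n B \<times> ?n C \<subseteq> lser" using *(3) by auto
  moreover have "?n (B \<union> C) = ?n B \<union> ?n C" by (rule image_Un)
  ultimately show ?thesis by (intro that) (simp_all only:)
qed

lemma inl_rewriteE:
  assumes "(s, t) \<in> inl_rewrite E sim inl"
  obtains X Y A B where "occ_seq s = X @ [A, B] @ Y" "occ_seq t = X @ [B, A] @ Y"
    "A \<times> B \<subseteq> linl"
proof -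
  from assms obtain w z A B where *: "s = w @ [A, B] @ z" "t = w @ [B, A] @ z"
    "A \<times> B \<subseteq> inl"
    by (auto simp: inl_rewrite_def)
  let ?n = "number (tally (\<lambda>_. 0) w)"
  have disj: "A \<inter> B = {}" "B \<inter> A = {}" using *(3) not_inl_refl by blast+
  have comm: "B \<union> A = A \<union> B" by blast
  note occ_list_append2[OF disj(1), of "\<lambda>_. 0" w z, folded *(1)]
    occ_list_append2[OF disj(2), of "\<lambda>_. 0" w z, folded *(2), unfolded comm]
  moreover have "?n A \<times> ?n B \<subseteq> linl" using *(3) by auto
  ultimately show ?thesis by (rule that)
qed

lemma rewrite_step_seqs:
  "(s, t) \<in> seq_rewrite E sim ser \<union> inl_rewrite E sim inl \<Longrightarrow>
   s \<in> step_sequences E sim \<and> t \<in> step_sequences E sim"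
  by (auto simp: seq_rewrite_def inl_rewrite_def)

lemma rewrite_rel_step_seqs:
  "(s, t) \<in> rewrite_rel\<^sup>+ \<Longrightarrow> s \<in> step_sequences E sim \<and> t \<in> step_sequences E sim"
proof -
  have "rewrite_rel \<subseteq> step_sequences E sim \<times> step_sequences E sim"
    by (intro subrelI) (metis rewrite_step_seqs UnE UnI1 UnI2 converseD mem_Sigma_iff rel_sym_def)
  then show "(s, t) \<in> rewrite_rel\<^sup>+ \<Longrightarrow> ?thesis"
    using trancl_subset_Sigma by blast
qed

lemma class_of_iff:
  "u \<in> class_of s \<longleftrightarrow> s \<in> step_sequences E sim \<and> (u = s \<or> (s, u) \<in> rewrite_rel\<^sup>+)"
  using rewrite_rel_step_seqs
  by (auto simp: gcomtrace_def step_equiv_def star_on_def)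

lemma class_of_refl: "s \<in> step_sequences E sim \<Longrightarrow> s \<in> class_of s"
  by (simp add: class_of_iff)

lemma class_of_step_seqs: "u \<in> class_of s \<Longrightarrow> u \<in> step_sequences E sim"
  using rewrite_rel_step_seqs by (auto simp: class_of_iff)

lemma class_of_trans: "u \<in> class_of s \<Longrightarrow> v \<in> class_of u \<Longrightarrow> v \<in> class_of s"
  unfolding class_of_iff by (metis trancl_trans)

lemma class_of_sym: "u \<in> class_of s \<Longrightarrow> s \<in> class_of u"
proof -
  have "sym rewrite_rel" by (auto simp: rel_sym_def sym_def)
  then have "sym (rewrite_rel\<^sup>+)" by (rule sym_trancl)
  then show "u \<in> class_of s \<Longrightarrow> s \<in> class_of u"
    using class_of_step_seqs by (auto simp: class_of_iff dest: symD)
qed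

lemma class_of_eq: "u \<in> class_of s \<Longrightarrow> class_of u = class_of s"
  using class_of_trans class_of_sym by blast

lemma class_of_rewrite:
  "u \<in> class_of s \<Longrightarrow> (u, v) \<in> rewrite_rel \<Longrightarrow> v \<in> class_of s"
  unfolding class_of_iff by (metis trancl.simps)

text \<open>Hides the representative and its counters: the rearrangements below handle lists of sets
  of occurrences only.\<close>

definition realizes :: "'a set list \<Rightarrow> 'a occ set list \<Rightarrow> bool" where
  "realizes s T \<longleftrightarrow> (\<exists>u\<in>class_of s. occ_seq u = T)"

text \<open>The factorisation of \<open>occ_seq u\<close> is pulled back to \<open>u\<close>, the
  rewriting is applied there, and \<open>subset_number\<close> shows that the two halves keep their
  numbers. Nonemptiness makes both halves steps.\<close>

lemma realizes_split:
  assumes "realizes s (X @ [B \<union> C] @ Y)" "B \<times> C \<subseteq> lser" "B \<noteq> {}" "C \<noteq> {}"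
  shows "realizes s (X @ [B, C] @ Y)"
proof -
  from assms obtain u where u: "u \<in> class_of s" "occ_seq u = X @ [B \<union> C] @ Y"
    by (auto simp: realizes_def)
  let ?w = "map ((`) fst) X" and ?z = "map ((`) fst) Y"
  let ?d = "tally (\<lambda>_. 0) ?w"
  note D = occ_list_eq_append1D[OF u(2)]
  have S: "u \<in> step_sequences E sim" using u(1) by (rule class_of_step_seqs)
  let ?v = "?w @ [fst ` B, fst ` C] @ ?z"
  have "(u, ?v) \<in> seq_rewrite E sim ser"
    unfolding seq_rewrite_def mem_Collect_eq
  proof (intro exI conjI)
    show "(u, ?v) = (?w @ [fst ` (B \<union> C)] @ ?z, ?w @ [fst ` B, fst ` C] @ ?z)"
      using D(1) by simp
    show "?w \<in> step_sequences E sim" "?z \<in> step_sequences E sim"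
      and A: "fst ` (B \<union> C) \<in> steps E sim"
      using S by (subst (asm) D(1), simp)+
    show "fst ` B \<in> steps E sim" "fst ` C \<in> steps E sim"
      using A assms(3,4) by (auto simp: steps_def)
    show "fst ` (B \<union> C) = fst ` B \<union> fst ` C" by (rule image_Un)
    show "fst ` B \<times> fst ` C \<subseteq> ser" using assms(2) by auto
  qed
  then have v: "?v \<in> class_of s"
    using u(1) by (auto simp: rel_sym_def intro: class_of_rewrite)
  have disj: "fst ` B \<inter> fst ` C = {}" using assms(2) not_ser_refl by fastforce
  have "number ?d (fst ` B) = B" "number ?d (fst ` C) = C"
    using subset_number[OF D(3)] by (blast intro: sym)+
  then have "occ_seq ?v = X @ [B, C] @ Y"
    by (simp only: occ_list_append2[OF disj] image_Un[symmetric] D(2,4)[symmetric])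
  with v show ?thesis by (auto simp: realizes_def)
qed

lemma realizes_fuse:
  assumes "realizes s (X @ [B, C] @ Y)" "B \<times> C \<subseteq> lser"
  shows "realizes s (X @ [B \<union> C] @ Y)"
proof -
  from assms obtain u where u: "u \<in> class_of s" "occ_seq u = X @ [B, C] @ Y"
    by (auto simp: realizes_def)
  let ?w = "map ((`) fst) X" and ?z = "map ((`) fst) Y"
  let ?d = "tally (\<lambda>_. 0) ?w"
  have disj: "fst ` B \<inter> fst ` C = {}" using assms(2) not_ser_refl by fastforce
  note D = occ_list_eq_append2D[OF u(2) disj]
  have S: "u \<in> step_sequences E sim" using u(1) by (rule class_of_step_seqs)
  let ?v = "?w @ [fst ` (B \<union> C)] @ ?z"
  have "(?v, u) \<in> seq_rewrite E sim ser"
    unfolding seq_rewrite_def mem_Collect_eq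
  proof (intro exI conjI)
    show "(?v, u) = (?w @ [fst ` (B \<union> C)] @ ?z, ?w @ [fst ` B, fst ` C] @ ?z)"
      using D(1) by simp
    show "?w \<in> step_sequences E sim" "?z \<in> step_sequences E sim"
      and BC: "fst ` B \<in> steps E sim" "fst ` C \<in> steps E sim"
      using S by (subst (asm) D(1), simp)+
    show ser: "fst ` B \<times> fst ` C \<subseteq> ser" using assms(2) by auto
    show "fst ` (B \<union> C) = fst ` B \<union> fst ` C" by (rule image_Un)
    have "fst ` B \<union> fst ` C \<in> steps E sim"
      using BC ser by (rule steps_Un)
    then show "fst ` (B \<union> C) \<in> steps E sim" by (simp add: image_Un)
  qed
  then have v: "?v \<in> class_of s"
    using u(1) by (auto simp: rel_sym_def intro: class_of_rewrite)
  have "number ?d (fst ` (B \<union> C)) = B \<union> C"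
    by (simp only: image_Un D(3,4)[symmetric])
  then have "occ_seq ?v = X @ [B \<union> C] @ Y"
    by (simp only: occ_list_append1 D(2,5)[symmetric] image_Un[symmetric] D(5)[symmetric, folded image_Un])
  with v show ?thesis by (auto simp: realizes_def)
qed

lemma realizes_swap_inl:
  assumes "realizes s (X @ [A, B] @ Y)" "A \<times> B \<subseteq> linl"
  shows "realizes s (X @ [B, A] @ Y)"
proof -
  from assms obtain u where u: "u \<in> class_of s" "occ_seq u = X @ [A, B] @ Y"
    by (auto simp: realizes_def)
  let ?w = "map ((`) fst) X" and ?z = "map ((`) fst) Y"
  let ?d = "tally (\<lambda>_. 0) ?w"
  have disj: "fst ` A \<inter> fst ` B = {}" "fst ` B \<inter> fst ` A = {}"
    using assms(2) not_inl_refl by fastforce+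
  note D = occ_list_eq_append2D[OF u(2) disj(1)]
  have S: "u \<in> step_sequences E sim" using u(1) by (rule class_of_step_seqs)
  let ?v = "?w @ [fst ` B, fst ` A] @ ?z"
  have "(u, ?v) \<in> inl_rewrite E sim inl"
    unfolding inl_rewrite_def mem_Collect_eq
  proof (intro exI conjI)
    show "(u, ?v) = (?w @ [fst ` A, fst ` B] @ ?z, ?w @ [fst ` B, fst ` A] @ ?z)"
      using D(1) by simp
    show "?w \<in> step_sequences E sim" "?z \<in> step_sequences E sim"
      and "fst ` A \<in> steps E sim" "fst ` B \<in> steps E sim"
      using S by (subst (asm) D(1), simp)+
    show "fst ` A \<times> fst ` B \<subseteq> inl" using assms(2) by auto
  qed
  then have v: "?v \<in> class_of s"
    using u(1) by (auto simp: rel_sym_def intro: class_of_rewrite)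
  have "fst ` B \<union> fst ` A = fst ` A \<union> fst ` B" by blast
  then have "occ_seq ?v = X @ [B, A] @ Y"
    by (simp only: occ_list_append2[OF disj(2)] D(2-5)[symmetric])
  with v show ?thesis by (auto simp: realizes_def)
qed

text \<open>The second alternative is not a single rewriting: the steps are fused and then split in
  the other order.\<close>

definition swappable :: "'a occ set \<Rightarrow> 'a occ set \<Rightarrow> bool" where
  "swappable A B \<longleftrightarrow> A \<times> B \<subseteq> linl \<or> A \<times> B \<subseteq> lser \<and> B \<times> A \<subseteq> lser"

lemma realizes_nonempty: "realizes s T \<Longrightarrow> A \<in> set T \<Longrightarrow> A \<noteq> {}"
proof -
  assume "realizes s T" "A \<in> set T"
  then obtain u where u: "u \<in> class_of s" "occ_seq u = T" by (auto simp: realizes_def)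
  have "fst ` A \<in> set (map ((`) fst) (occ_seq u))"
    using \<open>A \<in> set T\<close> u(2) unfolding set_map by blast
  then show "A \<noteq> {}"
    using class_of_step_seqs[OF u(1)] unfolding map_fst_occ_list by (auto simp: steps_def)
qed

lemma realizes_swap:
  assumes "realizes s (X @ [A, B] @ Y)" "swappable A B"
  shows "realizes s (X @ [B, A] @ Y)"
proof (cases "A \<times> B \<subseteq> linl")
  case True
  then show ?thesis using assms(1) realizes_swap_inl by blast
next
  case False
  then have *: "A \<times> B \<subseteq> lser" "B \<times> A \<subseteq> lser" using assms(2) by (auto simp: swappable_def)
  have "realizes s (X @ [B \<union> A] @ Y)"
    using realizes_fuse[OF assms(1) *(1)] by (simp add: Un_commute)
  moreover have "A \<noteq> {}" "B \<noteq> {}" using realizes_nonempty[OF assms(1)] by auto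
  ultimately show ?thesis using *(2) realizes_split by blast
qed

lemma realizes_move_left:
  assumes "realizes s (X @ [A] @ T @ Y)" "\<And>B. B \<in> set T \<Longrightarrow> swappable A B"
  shows "realizes s (X @ T @ [A] @ Y)"
  using assms
proof (induction T arbitrary: X)
  case (Cons B T)
  have "realizes s (X @ [B, A] @ (T @ Y))"
    using Cons.prems by (auto intro: realizes_swap[of s X A B "T @ Y", simplified])
  then show ?case using Cons.IH[of "X @ [B]"] Cons.prems(2) by simp
qed simp

text \<open>Insertion sort from the back: once the tail is partitioned, a head that fails
  \<open>P\<close> is carried to the right past the tail steps that satisfy \<open>P\<close>. All of
  these followed it in \<open>T\<close>, so only pairs in their original order need to be
  swappable.\<close>

lemma realizes_partition:
  assumes "realizes s (X @ T @ Y)" "disjoint_steps T"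
    and "\<And>A B. A \<in> set T \<Longrightarrow> B \<in> set T \<Longrightarrow> \<not> P A \<Longrightarrow> P B \<Longrightarrow>
      A \<times> B \<subseteq> list_before T \<Longrightarrow> swappable A B"
  shows "realizes s (X @ filter P T @ filter (\<lambda>A. \<not> P A) T @ Y)"
  using assms
proof (induction T arbitrary: X)
  case (Cons A T)
  have *: "realizes s (X @ [A] @ filter P T @ filter (\<lambda>A. \<not> P A) T @ Y)"
    using Cons.IH[of "X @ [A]"] Cons.prems by (simp add: subset_iff)
  show ?case
  proof (cases "P A")
    case False
    have "swappable A B" if "B \<in> set (filter P T)" for B
      using that False by (intro Cons.prems(3)) auto
    from realizes_move_left[OF * this] show ?thesis using False by simp
  qed (use * in simp)
qed simp

end

section \<open>Invariance of the relations under rewriting\<close>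

text \<open>Splitting only adds order. The added pairs are new because the steps are disjoint:
  elements of \<open>B \<union> C\<close> occur in no other step.\<close>

lemma before_split:
  assumes "occ_seq s = X @ [B \<union> C] @ Y" "occ_seq t = X @ [B, C] @ Y"
  shows "occs t = occs s" "before t = before s \<union> B \<times> C"
    "B \<times> C \<inter> before s = {}"
proof -
  have 1: "disjoint_steps (X @ [B \<union> C] @ Y)" "disjoint_steps (X @ [B, C] @ Y)"
    unfolding assms[symmetric] by (rule disjoint_steps_occ_list)+
  show "occs t = occs s" "before t = before s \<union> B \<times> C"
    by (auto simp: occs_eq_Union before_eq assms list_before_append)
  show "B \<times> C \<inter> before s = {}"
    using 1 list_before_subset[of X] list_before_subset[of Y]
    unfolding before_eq assms list_before_append disjoint_steps_append
    by auto blast+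
qed

lemma before_swap:
  assumes "occ_seq s = X @ [A, B] @ Y" "occ_seq t = X @ [B, A] @ Y"
  shows "occs t = occs s" "before t - B \<times> A = before s - A \<times> B"
    "B \<times> A \<subseteq> before t"
    "A \<in> set (occ_seq s)" "B \<in> set (occ_seq s)"
proof -
  have 1: "disjoint_steps (X @ [A, B] @ Y)" "disjoint_steps (X @ [B, A] @ Y)"
    unfolding assms[symmetric] by (rule disjoint_steps_occ_list)+
  show "occs t = occs s" "B \<times> A \<subseteq> before t"
    "A \<in> set (occ_seq s)" "B \<in> set (occ_seq s)"
    by (auto simp: occs_eq_Union before_eq assms list_before_append)
  \<comment> \<open>The pairs not both taken from the two exchanged steps; their order is common to
    \<open>s\<close> and \<open>t\<close>.\<close>
  define R where "R = list_before X \<union> list_before Y \<union> \<Union> (set X) \<times> (A \<union> B \<union> \<Union> (set Y))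
    \<union> (A \<union> B) \<times> \<Union> (set Y)"
  have "A \<times> B \<inter> R = {}" "B \<times> A \<inter> R = {}"
    using 1 list_before_subset[of X] list_before_subset[of Y]
    unfolding disjoint_steps_append R_def by auto blast+
  moreover have "before s = R \<union> A \<times> B" "before t = R \<union> B \<times> A"
    by (auto simp: R_def before_eq assms list_before_append)
  ultimately show "before t - B \<times> A = before s - A \<times> B" by blast
qed

section \<open>Reflexive transitive closure on a carrier\<close>

lemma star_on_refl: "x \<in> X \<Longrightarrow> (x, x) \<in> star_on X R"
  and star_on_base: "p \<in> R \<Longrightarrow> p \<in> star_on X R"
  by (cases p; auto simp: star_on_def)+

lemma star_on_trans:
  "(x, y) \<in> star_on X R \<Longrightarrow> (y, z) \<in> star_on X R \<Longrightarrow> (x, z) \<in> star_on X R"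
  by (auto simp: star_on_def dest: trancl_trans)

lemma star_on_mono: "R \<subseteq> S \<Longrightarrow> star_on X R \<subseteq> star_on X S"
  unfolding star_on_def by (meson Un_mono order_refl subsetI trancl_mono)

text \<open>Serves to remove \<open>R3 = R1 \<inter> star_on X R2\<close> from the closure of
  \<open>R3 \<union> R2\<close>.\<close>

lemma star_on_absorb:
  assumes "S \<subseteq> star_on X R"
  shows "star_on X (S \<union> R) = star_on X R"
proof
  have "(x, y) \<in> (S \<union> R)\<^sup>+ \<Longrightarrow> (x, y) \<in> star_on X R" for x y
  proof (induction rule: trancl_induct)
    case (base y)
    then show ?case using assms by (auto intro: star_on_base)
  next
    case (step y z)
    then show ?case using assms by (blast intro: star_on_base star_on_trans)
  qed
  then show "star_on X (S \<union> R) \<subseteq> star_on X R" by (auto simp: star_on_def)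
  show "star_on X R \<subseteq> star_on X (S \<union> R)" by (rule star_on_mono) blast
qed

text \<open>No chain leads to an earlier step. In particular, occurrences related in both directions
  share a step.\<close>

lemma star_on_pos_le:
  assumes "R \<subseteq> not_after s" "(\<alpha>, \<beta>) \<in> star_on (occs s) R"
  shows "\<alpha> \<in> occs s" "\<beta> \<in> occs s" "pos s \<alpha> \<le> pos s \<beta>"
proof -
  have "(\<alpha>, \<beta>) \<in> R\<^sup>+ \<Longrightarrow> \<alpha> \<in> occs s \<and> \<beta> \<in> occs s \<and> pos s \<alpha> \<le> pos s \<beta>"
    by (induction rule: trancl_induct) (use assms(1) in \<open>fastforce simp: not_after_def\<close>)+
  then show "\<alpha> \<in> occs s" "\<beta> \<in> occs s" "pos s \<alpha> \<le> pos s \<beta>"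
    using assms(2) by (auto simp: star_on_def)
qed

context gcomtrace_alph begin

abbreviation "sqs s \<equiv> occ_sqsubset ser inl s"
abbreviation "prc s \<equiv> occ_prec ser inl s"
abbreviation "sq_star s \<equiv> star_on (occs s) (sqs s)"

lemma prc_iff:
  "(\<alpha>, \<beta>) \<in> prc s \<longleftrightarrow> (\<alpha>, \<beta>) \<in> before s \<and>
     ((\<alpha>, \<beta>) \<notin> lser \<union> linl \<or>
      (\<alpha>, \<beta>) \<in> linl \<and> (\<exists>\<gamma>\<in>occs s. \<exists>\<delta>\<in>occs s. (\<gamma>, \<delta>) \<notin> linl \<and>
         (\<alpha>, \<gamma>) \<in> sq_star s \<and> (\<gamma>, \<alpha>) \<in> sq_star s \<and>
         (\<delta>, \<beta>) \<in> sq_star s \<and> (\<beta>, \<delta>) \<in> sq_star s) \<or>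
      (\<alpha>, \<beta>) \<in> lser \<and> (\<exists>\<delta>\<in>occs s. \<exists>\<gamma>\<in>occs s. (\<delta>, \<gamma>) \<in> before s \<and> (\<delta>, \<gamma>) \<notin> lser \<and>
         (\<alpha>, \<delta>) \<in> sq_star s \<and> (\<delta>, \<beta>) \<in> sq_star s \<and>
         (\<alpha>, \<gamma>) \<in> sq_star s \<and> (\<gamma>, \<beta>) \<in> sq_star s))"
proof -
  let ?M = "rel_mutual (sq_star s)"
  have inl: "p \<in> occ_inl inl s \<longleftrightarrow> p \<in> linl" if "p \<in> occs s \<times> occs s" for p
    using that by (auto simp: occ_inl_def)
  have bef: "(\<alpha>, \<beta>) \<in> before s \<Longrightarrow> (\<alpha>, \<beta>) \<in> occs s \<times> occs s" by (auto simp: before_def)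
  have compl: "(\<gamma>, \<delta>) \<in> rel_compl (occs s) (occ_inl inl s) \<longleftrightarrow>
      \<gamma> \<in> occs s \<and> \<delta> \<in> occs s \<and> (\<gamma>, \<delta>) \<notin> linl" for \<gamma> \<delta>
    by (auto simp: rel_compl_def occ_inl_def)
  have mutual: "(x, y) \<in> ?M \<longleftrightarrow> (x, y) \<in> sq_star s \<and> (y, x) \<in> sq_star s" for x y
    by (simp add: rel_mutual_def)
  have "(\<alpha>, \<beta>) \<in> ?M O rel_compl (occs s) (occ_inl inl s) O ?M \<longleftrightarrow>
    (\<exists>\<gamma>\<in>occs s. \<exists>\<delta>\<in>occs s. (\<gamma>, \<delta>) \<notin> linl \<and>
         (\<alpha>, \<gamma>) \<in> sq_star s \<and> (\<gamma>, \<alpha>) \<in> sq_star s \<and>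
         (\<delta>, \<beta>) \<in> sq_star s \<and> (\<beta>, \<delta>) \<in> sq_star s)"
    unfolding relcomp_unfold mem_Collect_eq prod.case compl mutual by blast
  then show ?thesis
    using inl[OF bef] by (cases "(\<alpha>, \<beta>) \<in> before s") (simp_all add: occ_prec_def Let_def)
qed

lemma sqs_not_after: "sqs s \<subseteq> not_after s"
  by (auto simp: occ_sqsubset_def)

lemmas sq_star_pos_le = star_on_pos_le[OF sqs_not_after]

text \<open>Only pairs in \<open>B \<times> C\<close> change, and these lie in \<open>lser\<close>.
  Reversed, such a pair is excluded from \<sqsubset> by definition; as itself, it could enter
  \<prec> only by clause (iii), whose witnesses are not in \<open>lser\<close> and so were already
  ordered in \<open>s\<close>.\<close>

lemma invariant_split:
  assumes "occ_seq s = X @ [B \<union> C] @ Y" "occ_seq t = X @ [B, C] @ Y" "B \<times> C \<subseteq> lser"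
  shows "occs t = occs s" "sqs t = sqs s" "prc t = prc s"
proof -
  note bef = before_split[OF assms(1,2)]
  show occs: "occs t = occs s" by (rule bef(1))
  show sqs: "sqs t = sqs s"
    using assms(3) by (auto simp: occ_sqsubset_def not_after_eq bef)
  have ser_sim: "p \<notin> linl" if "p \<in> lser" for p
    using that ser_simD not_sim_inl by (auto simp: inv_image_def)
  show "prc t = prc s"
  proof (rule equalityI; rule subrelI)
    fix \<alpha> \<beta> assume prec: "(\<alpha>, \<beta>) \<in> prc t"
    show "(\<alpha>, \<beta>) \<in> prc s"
    proof (cases "(\<alpha>, \<beta>) \<in> B \<times> C")
      case True
      then have same: "(\<alpha>, \<beta>) \<in> lser" "(\<alpha>, \<beta>) \<notin> linl" "(\<alpha>, \<beta>) \<notin> before s"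
        using assms(3) ser_sim bef(3) by blast+
      then obtain \<delta> \<gamma> where *: "(\<delta>, \<gamma>) \<in> before t" "(\<delta>, \<gamma>) \<notin> lser"
        "(\<alpha>, \<delta>) \<in> sq_star s" "(\<gamma>, \<beta>) \<in> sq_star s"
        using prec unfolding prc_iff sqs occs by blast
      \<comment> \<open>The witnesses lie between \<open>\<alpha>\<close> and \<open>\<beta>\<close>
        and are separated in \<open>s\<close>, so they would separate \<open>\<alpha>\<close> from
        \<open>\<beta>\<close> in \<open>s\<close>, contrary to both being in
        \<open>B \<union> C\<close>.\<close>
      have "(\<delta>, \<gamma>) \<in> before s" using * assms(3) bef(2) by blast
      then have "pos s \<alpha> < pos s \<beta>"
        using sq_star_pos_le(3)[OF *(3)] sq_star_pos_le(3)[OF *(4)] by (simp add: before_def)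
      moreover have "\<alpha> \<in> occs s" "\<beta> \<in> occs s"
        using sq_star_pos_le(1)[OF *(3)] sq_star_pos_le(2)[OF *(4)] .
      ultimately show ?thesis using same(3) by (simp add: before_def)
    next
      case False
      then have "(\<alpha>, \<beta>) \<in> before s" using prec bef(2) by (auto simp: prc_iff)
      moreover have "(\<delta>, \<gamma>) \<in> before s" if "(\<delta>, \<gamma>) \<in> before t" "(\<delta>, \<gamma>) \<notin> lser" for \<delta> \<gamma>
        using that assms(3) bef(2) by blast
      ultimately show ?thesis
        using prec unfolding prc_iff sqs occs by blast
    qed
  next
    fix \<alpha> \<beta> assume "(\<alpha>, \<beta>) \<in> prc s"
    then show "(\<alpha>, \<beta>) \<in> prc t"
      unfolding prc_iff sqs occs bef(2) by blast
  qed
qed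

text \<open>Only an inclusion of \<open>\<prec>\<close> is stated, since the situation is symmetric in \<open>s\<close> and \<open>t\<close>.\<close>

lemma invariant_swap_subset:
  assumes "occ_seq s = X @ [A, B] @ Y" "occ_seq t = X @ [B, A] @ Y" "A \<times> B \<subseteq> linl"
  shows "occs t = occs s" "sqs t = sqs s" "prc s \<subseteq> prc t"
proof -
  note bef = before_swap[OF assms(1,2)]
  show occs: "occs t = occs s" by (rule bef(1))
  have BA: "B \<times> A \<subseteq> linl" using assms(3) inl_symD by (auto simp: inv_image_def)
  have outside: "p \<in> before t" if "p \<in> before s" "p \<notin> A \<times> B" for p
    using bef(2) that by blast
  have outside': "p \<in> before s" if "p \<in> before t" "p \<notin> B \<times> A" for p
    using bef(2) that by blast
  have neither: "(x, y) \<in> before t \<longleftrightarrow> (x, y) \<in> before s" if "(x, y) \<notin> linl" for x y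
    using that outside outside' assms(3) BA by blast
  have linl_sym: "(x, y) \<in> linl \<longleftrightarrow> (y, x) \<in> linl" for x y
    using inl_symD by (auto simp: inv_image_def)
  show sqs: "sqs t = sqs s"
  proof -
    have "(x, y) \<in> sqs t \<longleftrightarrow> (x, y) \<in> sqs s" for x y
    proof (cases "(y, x) \<in> linl")
      case True then show ?thesis by (auto simp: occ_sqsubset_def)
    next
      case False then show ?thesis
        by (auto simp: occ_sqsubset_def not_after_eq occs neither)
    qed
    then show ?thesis by auto
  qed
  have ser_inl: "p \<notin> linl" if "p \<in> lser" for p
    using that ser_simD not_sim_inl by (auto simp: inv_image_def)
  show "prc s \<subseteq> prc t"
  proof (rule subrelI)
    fix \<alpha> \<beta> assume prec: "(\<alpha>, \<beta>) \<in> prc s"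
    have "(\<alpha>, \<beta>) \<in> before s" using prec by (simp add: prc_iff)
    consider (none) "(\<alpha>, \<beta>) \<notin> lser \<union> linl"
      | (inl) "(\<alpha>, \<beta>) \<in> linl" | (ser) "(\<alpha>, \<beta>) \<in> lser" "(\<alpha>, \<beta>) \<notin> linl"
      using ser_inl by blast
    then show "(\<alpha>, \<beta>) \<in> prc t"
    proof cases
      case none
      then show ?thesis using \<open>(\<alpha>, \<beta>) \<in> before s\<close> neither by (auto simp: prc_iff)
    next
      case inl
      then obtain \<gamma> \<delta> where *: "\<gamma> \<in> occs s" "\<delta> \<in> occs s" "(\<gamma>, \<delta>) \<notin> linl"
         "(\<alpha>, \<gamma>) \<in> sq_star s" "(\<gamma>, \<alpha>) \<in> sq_star s"
         "(\<delta>, \<beta>) \<in> sq_star s" "(\<beta>, \<delta>) \<in> sq_star s"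
        using prec ser_inl unfolding prc_iff by blast
      \<comment> \<open>The witnesses of clause (ii) lie in the steps of \<open>\<alpha>\<close> and
        \<open>\<beta>\<close>. If these were \<open>A\<close> and \<open>B\<close>, the witnesses
        would be in \<open>linl\<close>; hence the exchange does not affect the pair.\<close>
      have "pos s \<alpha> = pos s \<gamma>" "pos s \<beta> = pos s \<delta>"
        using *(4-7) sq_star_pos_le(3) by (meson le_antisym)+
      then have "\<gamma> \<in> A" if "\<alpha> \<in> A"
        using same_step_iff[OF bef(4) that *(1)] by simp
      moreover have "\<delta> \<in> B" if "\<beta> \<in> B"
        using same_step_iff[OF bef(5) that *(2)] \<open>pos s \<beta> = pos s \<delta>\<close> by simp
      ultimately have "(\<alpha>, \<beta>) \<notin> A \<times> B" using *(3) assms(3) by blast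
      then have "(\<alpha>, \<beta>) \<in> before t" using \<open>(\<alpha>, \<beta>) \<in> before s\<close> outside by blast
      then show ?thesis using inl * unfolding prc_iff sqs occs by blast
    next
      case ser
      then obtain \<delta> \<gamma> where *: "\<delta> \<in> occs s" "\<gamma> \<in> occs s" "(\<delta>, \<gamma>) \<in> before s" "(\<delta>, \<gamma>) \<notin> lser"
         "(\<alpha>, \<delta>) \<in> sq_star s" "(\<delta>, \<beta>) \<in> sq_star s"
         "(\<alpha>, \<gamma>) \<in> sq_star s" "(\<gamma>, \<beta>) \<in> sq_star s"
        using prec unfolding prc_iff by blast
      \<comment> \<open>If the exchange reverses the witnesses of clause (iii), they trade roles:
        the reversed pair is in \<open>linl\<close>, hence not in \<open>lser\<close>, and both lie
        between \<open>\<alpha>\<close> and \<open>\<beta>\<close>.\<close>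
      have "\<exists>\<delta>'\<in>{\<delta>, \<gamma>}. \<exists>\<gamma>'\<in>{\<delta>, \<gamma>}. (\<delta>', \<gamma>') \<in> before t \<and> (\<delta>', \<gamma>') \<notin> lser"
      proof (cases "(\<delta>, \<gamma>) \<in> A \<times> B")
        case True
        then have "(\<gamma>, \<delta>) \<in> before t" "(\<gamma>, \<delta>) \<notin> lser" using bef(3) BA ser_inl by blast+
        then show ?thesis by blast
      next
        case False
        then show ?thesis using * outside by blast
      qed
      moreover have "(\<alpha>, \<beta>) \<in> before t"
        using neither ser \<open>(\<alpha>, \<beta>) \<in> before s\<close> by blast
      ultimately show ?thesis using ser * unfolding prc_iff sqs occs by blast
    qed
  qed
qed

lemma invariant_rewrite:
  assumes "(s, t) \<in> rewrite_rel"
  shows "occs t = occs s \<and> sqs t = sqs s \<and> prc t = prc s"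
proof -
  have "occs t = occs s \<and> sqs t = sqs s \<and> prc t = prc s"
    if "(s, t) \<in> seq_rewrite E sim ser" for s t
    using that by (elim seq_rewriteE) (metis invariant_split)
  moreover have "occs t = occs s \<and> sqs t = sqs s \<and> prc t = prc s"
    if "(s, t) \<in> inl_rewrite E sim inl" for s t
    using that
  proof (rule inl_rewriteE)
    fix X Y A B assume *: "occ_seq s = X @ [A, B] @ Y" "occ_seq t = X @ [B, A] @ Y"
      "A \<times> B \<subseteq> linl"
    have "B \<times> A \<subseteq> linl" using *(3) inl_symD by (auto simp: inv_image_def)
    then show ?thesis
      using invariant_swap_subset[OF *] invariant_swap_subset(3)[OF *(2,1)] by blast
  qed
  ultimately show ?thesis using assms unfolding rel_sym_def by (metis Un_iff converse_iff)
qed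

lemma invariant_class_of:
  assumes "u \<in> class_of s"
  shows "occs u = occs s" "sqs u = sqs s" "prc u = prc s"
proof -
  have "(s, u) \<in> rewrite_rel\<^sup>+ \<Longrightarrow> occs u = occs s \<and> sqs u = sqs s \<and> prc u = prc s"
    by (induction rule: trancl_induct) (use invariant_rewrite in auto)
  then show "occs u = occs s" "sqs u = sqs s" "prc u = prc s"
    using assms by (auto simp: class_of_iff)
qed

lemma same_step_sim:
  assumes "s \<in> step_sequences E sim" "A \<in> set (occ_seq s)" "\<alpha> \<in> A" "\<beta> \<in> A" "\<alpha> \<noteq> \<beta>"
  shows "(fst \<alpha>, fst \<beta>) \<in> sim"
proof -
  obtain X Y where "occ_seq s = X @ [A] @ Y"
    using assms(2) by (metis append_Cons append_Nil split_list)
  note D = occ_list_eq_append1D[OF this]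
  have "fst ` A \<in> steps E sim" using assms(1) by (subst (asm) D(1)) simp
  \<comment> \<open>Within one step the label determines the number, so distinct occurrences have
    distinct labels.\<close>
  moreover have "fst \<alpha> \<noteq> fst \<beta>"
  proof -
    have "\<gamma> = (fst \<gamma>, Suc (tally (\<lambda>_. 0) (map ((`) fst) X) (fst \<gamma>)))" if "\<gamma> \<in> A" for \<gamma>
    proof -
      have "\<gamma> \<in> number (tally (\<lambda>_. 0) (map ((`) fst) X)) (fst ` A)"
        using that by (subst D(3)[symmetric])
      then show ?thesis by auto
    qed
    then show ?thesis using assms(3-5) by metis
  qed
  ultimately show ?thesis using assms(3,4) by (auto simp: steps_def)
qed

end

section \<open>Completeness\<close>

lemma length_le_card_Union:
  "disjoint_steps T \<Longrightarrow> \<forall>A\<in>set T. A \<noteq> {} \<and> finite A \<Longrightarrow> length T \<le> card (\<Union> (set T))"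
proof (induction T)
  case (Cons A T)
  then have "card (A \<union> \<Union> (set T)) = card A + card (\<Union> (set T))"
    by (intro card_Un_disjoint) auto
  moreover have "0 < card A" using Cons.prems(2) by (auto simp: card_gt_0_iff)
  ultimately show ?case using Cons by simp
qed simp

lemma list_before_filter: "list_before (filter P T) \<subseteq> list_before T"
  by (induction T) auto

lemma disjoint_steps_filter: "disjoint_steps T \<Longrightarrow> disjoint_steps (filter P T)"
  by (induction T) auto

context gcomtrace_alph begin

text \<open>All members share the same occurrences and every step uses at least one of them. The
  bound guarantees a longest member.\<close>

lemma class_of_length:
  assumes "u \<in> class_of s"
  shows "length u \<le> card (occs s)"
proof -
  have u: "u \<in> step_sequences E sim" using assms by (rule class_of_step_seqs)
  have "A \<noteq> {} \<and> finite A" if A: "A \<in> set (occ_seq u)" for A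
  proof -
    obtain X Y where "occ_seq u = X @ [A] @ Y"
      using A by (auto simp: in_set_conv_decomp)
    note D = occ_list_eq_append1D[OF this]
    have step: "fst ` A \<in> steps E sim" using u by (subst (asm) D(1)) simp
    then have "fst ` A \<subseteq> E" "finite E"
      using alphabet by (simp_all add: steps_def gcomtrace_alphabet_def)
    then have "finite (fst ` A)" by (rule finite_subset)
    then have "finite (number (tally (\<lambda>_. 0) (map ((`) fst) X)) (fst ` A))" by (rule finite_imageI)
    then have "finite A" by (subst D(3))
    moreover have "A \<noteq> {}" using step by (auto simp: steps_def)
    ultimately show ?thesis by blast
  qed
  then have "length (occ_seq u) \<le> card (occs u)"
    unfolding occs_eq_Union by (intro length_le_card_Union disjoint_steps_occ_list) blast
  then show ?thesis using invariant_class_of[OF assms] by simp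
qed

text \<open>Inside a step neither occurrence is after the other, so \<sqsubset> can fail only
  through the labels; \<open>inl\<close> is excluded because labels in a step are related by
  \<open>sim\<close>.\<close>

lemma ser_of_same_step:
  assumes "s \<in> step_sequences E sim" "A \<in> set (occ_seq s)" "\<alpha> \<in> A" "\<beta> \<in> A"
    "\<alpha> \<noteq> \<beta>" "(\<alpha>, \<beta>) \<notin> sqs s"
  shows "(\<beta>, \<alpha>) \<in> lser"
proof -
  have "\<alpha> \<in> occs s" "\<beta> \<in> occs s" using assms(2-4) by (auto simp: occs_eq_Union)
  then have "(\<alpha>, \<beta>) \<in> not_after s"
    using same_step_iff[OF assms(2,3)] assms(4,5) by (simp add: not_after_def)
  then have "(fst \<beta>, fst \<alpha>) \<in> ser \<union> inl"
    using assms(6) by (simp add: occ_sqsubset_def)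
  moreover have "(fst \<beta>, fst \<alpha>) \<in> sim"
    using same_step_sim[OF assms(1,2,4,3)] assms(5) by blast
  ultimately show ?thesis using not_sim_inl by auto
qed

text \<open>By \<open>sq_star_pos_le\<close> the steps are then exactly the strongly connected
  components of \<open>sqs s\<close>.\<close>

definition atomic :: "'a set list \<Rightarrow> bool" where
  "atomic s \<longleftrightarrow> (\<forall>A\<in>set (occ_seq s). \<forall>\<alpha>\<in>A. \<forall>\<beta>\<in>A. (\<alpha>, \<beta>) \<in> sq_star s)"

lemma ex_atomic:
  assumes "s \<in> step_sequences E sim"
  obtains u where "u \<in> class_of s" "atomic u"
proof -
  obtain u where u: "u \<in> class_of s"
    and max: "\<And>v. v \<in> class_of s \<Longrightarrow> length v \<le> length u"
    using ex_has_greatest_nat[of "\<lambda>v. v \<in> class_of s" s length "Suc (card (occs s))",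
      OF class_of_refl[OF assms]] class_of_length[of _ s] by (auto simp: less_Suc_eq_le)
  have S: "u \<in> step_sequences E sim" using u by (rule class_of_step_seqs)
  have "(\<alpha>, \<beta>) \<in> sq_star u" if A: "A \<in> set (occ_seq u)" "\<alpha> \<in> A" "\<beta> \<in> A" for A \<alpha> \<beta>
  proof (rule ccontr)
    assume neg: "(\<alpha>, \<beta>) \<notin> sq_star u"
    \<comment> \<open>\<open>C\<close> is the part of \<open>A\<close> reachable from
      \<open>\<alpha>\<close>. No \<sqsubset> pair leads from \<open>C\<close> to the rest of
      \<open>A\<close>, so \<open>A\<close> splits into \<open>B\<close> followed by
      \<open>C\<close>, giving a longer member.\<close>
    define C where "C = {\<gamma>\<in>A. (\<alpha>, \<gamma>) \<in> sq_star u}"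
    define B where "B = A - C"
    have "\<alpha> \<in> C" using A by (auto simp: C_def occs_eq_Union intro: star_on_refl)
    moreover have "\<beta> \<in> B" using A neg by (simp add: B_def C_def)
    moreover have "B \<times> C \<subseteq> lser"
    proof (rule subrelI)
      fix x y assume "(x, y) \<in> B \<times> C"
      then have xy: "x \<in> A" "y \<in> A" "(\<alpha>, y) \<in> sq_star u" "(\<alpha>, x) \<notin> sq_star u"
        by (simp_all add: B_def C_def)
      then have "(y, x) \<notin> sqs u" using star_on_trans[OF xy(3) star_on_base] by blast
      moreover have "y \<noteq> x" using xy by blast
      ultimately show "(x, y) \<in> lser"
        using ser_of_same_step[OF S A(1) xy(2,1)] by blast
    qed
    moreover obtain X Y where XY: "occ_seq u = X @ [A] @ Y"
      using A(1) by (auto simp: in_set_conv_decomp)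
    moreover have "B \<union> C = A" by (auto simp: B_def C_def)
    ultimately obtain v where v: "v \<in> class_of s" "occ_seq v = X @ [B, C] @ Y"
      using realizes_split[of s X B C Y] u unfolding realizes_def by auto
    have "length v = Suc (length u)"
      using arg_cong[OF v(2), of length] arg_cong[OF XY, of length] by simp
    then show False using max[OF v(1)] by simp
  qed
  then show ?thesis using that u by (auto simp: atomic_def)
qed

text \<open>This is \<open>R\<^sub>2\<^sup>*\<close> in the closure \<open>\<bowtie>\<close> that defines \<open>G\<^bsup>{s}\<^esup>\<close>; as \<open>R\<^sub>3 \<subseteq> R\<^sub>2\<^sup>*\<close>, it
  is also \<open>(R\<^sub>3 \<union> R\<^sub>2)\<^sup>*\<close>.\<close>

definition forced :: "'a set list \<Rightarrow> 'a occ rel" where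
  "forced s = star_on (occs s) (prc s \<union> sqs s)"

lemma forced_trans: "(x, y) \<in> forced s \<Longrightarrow> (y, z) \<in> forced s \<Longrightarrow> (x, z) \<in> forced s"
  unfolding forced_def by (rule star_on_trans)

lemma forced_base: "p \<in> prc s \<Longrightarrow> p \<in> forced s" "p \<in> sqs s \<Longrightarrow> p \<in> forced s"
  and forced_refl: "\<alpha> \<in> occs s \<Longrightarrow> (\<alpha>, \<alpha>) \<in> forced s"
  and sq_star_forced: "p \<in> sq_star s \<Longrightarrow> p \<in> forced s"
  using star_on_mono[of "sqs s" "prc s \<union> sqs s" "occs s"]
  by (auto simp: forced_def intro: star_on_base star_on_refl)

lemma atomic_forced:
  "atomic s \<Longrightarrow> A \<in> set (occ_seq s) \<Longrightarrow> \<alpha> \<in> A \<Longrightarrow> \<beta> \<in> A \<Longrightarrow> (\<alpha>, \<beta>) \<in> forced s"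
  unfolding atomic_def by (blast intro: sq_star_forced)

lemma prc_before: "prc s \<subseteq> before s"
  using prc_iff by auto

text \<open>Since \<open>forced\<close> is the same for all members of the class, this bound will
  hold for the positions in each of them.\<close>

lemma forced_pos_le:
  assumes "(\<alpha>, \<beta>) \<in> forced s"
  shows "\<alpha> \<in> occs s" "\<beta> \<in> occs s" "pos s \<alpha> \<le> pos s \<beta>"
proof -
  have "before s \<subseteq> not_after s" by (auto simp: before_def not_after_def)
  then have "prc s \<union> sqs s \<subseteq> not_after s" using prc_before sqs_not_after by blast
  from star_on_pos_le[OF this assms[unfolded forced_def]]
  show "\<alpha> \<in> occs s" "\<beta> \<in> occs s" "pos s \<alpha> \<le> pos s \<beta>" .
qed

text \<open>The middle factor is \<open>R3\<close>. As \<open>occ_inl\<close> is symmetric, the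
  intersection with \<open>forced\<close> selects the direction in which its pairs occur.\<close>

lemma seq_structure_eq:
  "seq_structure ser inl s =
    (occs s,
     rel_sym (forced s O ((prc s \<union> occ_inl inl s) \<inter> forced s) O forced s)
       \<union> (prc s \<union> occ_inl inl s),
     forced s - Id_on (occs s))"
proof -
  have "star_on (occs s) ((prc s \<union> occ_inl inl s) \<inter> forced s \<union> (prc s \<union> sqs s)) = forced s"
    unfolding forced_def by (rule star_on_absorb) blast
  then show ?thesis
    by (simp add: seq_structure_def bowtie_closure_def Let_def closure_prec_def
        closure_sqsubset_def forced_def[symmetric])
qed

section \<open>Rearranging strongly connected steps\<close>

lemma realizes_fuse_list:
  assumes "realizes s (X @ T @ Y)" "T \<noteq> []" "list_before T \<subseteq> lser"
  shows "realizes s (X @ [\<Union> (set T)] @ Y)"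
  using assms
proof (induction T arbitrary: X)
  case (Cons A T)
  show ?case
  proof (cases "T = []")
    case False
    have "realizes s ((X @ [A]) @ [\<Union> (set T)] @ Y)"
      using Cons.prems False by (intro Cons.IH) auto
    then show ?thesis
      using realizes_fuse[of s X A "\<Union> (set T)" Y] Cons.prems(3) by simp
  qed (use Cons.prems in simp)
qed simp

text \<open>Without any \<open>linl\<close> pair, failure of clause (i) gives \<open>lser\<close> in
  one direction and failure of \<sqsubset> gives it in the other. With one \<open>linl\<close> pair
  all pairs are in \<open>linl\<close>, since a pair outside would supply the witnesses of clause
  (ii).\<close>

lemma swappable_of_unforced:
  assumes "A \<times> B \<subseteq> before s" "atomic s" "A \<in> set (occ_seq s)" "B \<in> set (occ_seq s)"
    "A \<times> B \<inter> (prc s \<union> sqs s) = {}"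
  shows "swappable A B"
proof (cases "A \<times> B \<inter> linl = {}")
  case True
  have linl_sym: "(y, x) \<in> linl \<Longrightarrow> (x, y) \<in> linl" for x y
    using inl_symD by auto
  have "(x, y) \<in> lser \<and> (y, x) \<in> lser" if "x \<in> A" "y \<in> B" for x y
  proof
    have bef: "(x, y) \<in> before s" "(x, y) \<notin> prc s" "(x, y) \<notin> sqs s" "(x, y) \<notin> linl"
      using assms(1,5) True that by blast+
    then show "(x, y) \<in> lser" by (simp add: prc_iff)
    have "(x, y) \<in> not_after s" using bef(1) by (auto simp: before_def not_after_def)
    then have "(y, x) \<in> lser \<union> linl" using bef(3) by (auto simp: occ_sqsubset_def)
    then show "(y, x) \<in> lser" using bef(4) linl_sym by blast
  qed
  then show ?thesis unfolding swappable_def by blast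
next
  case False
  then obtain x y where xy: "x \<in> A" "y \<in> B" "(x, y) \<in> linl" by blast
  have "(x', y') \<in> linl" if "x' \<in> A" "y' \<in> B" for x' y'
  proof (rule ccontr)
    assume "(x', y') \<notin> linl"
    moreover have "(x, x') \<in> sq_star s" "(x', x) \<in> sq_star s" "(y', y) \<in> sq_star s"
        "(y, y') \<in> sq_star s"
      using assms(2-4) xy that unfolding atomic_def by blast+
    moreover have "x' \<in> occs s" "y' \<in> occs s" using that assms(3,4) by (auto simp: occs_eq_Union)
    moreover have "(x, y) \<in> before s" using assms(1) xy by blast
    ultimately have "(x, y) \<in> prc s" using xy(3) unfolding prc_iff by blast
    then show False using assms(5) xy by blast
  qed
  then show ?thesis unfolding swappable_def by blast
qed

text \<open>A strongly connected step lies inside the down-set \<open>D\<close> or misses it. A step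
  missing \<open>D\<close> has no forced pair into a step inside \<open>D\<close>, so the two can be
  swapped.\<close>

lemma realizes_down_set_first:
  assumes "realizes s (X @ T @ Y)" "atomic s" "set T \<subseteq> set (occ_seq s)"
    "disjoint_steps T" "list_before T \<subseteq> before s"
    and down: "(forced s)\<inverse> `` D \<subseteq> D"
  shows "realizes s (X @ filter (\<lambda>A. A \<subseteq> D) T @ filter (\<lambda>A. \<not> A \<subseteq> D) T @ Y)"
  using assms(1,4)
proof (rule realizes_partition)
  fix A B assume *: "A \<in> set T" "B \<in> set T" "\<not> A \<subseteq> D" "B \<subseteq> D" "A \<times> B \<subseteq> list_before T"
  have A: "A \<in> set (occ_seq s)" using *(1) assms(3) by blast
  have "x \<notin> D" if "x \<in> A" for x
    using *(3) down atomic_forced[OF assms(2) A _ that] by blast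
  then have "A \<times> B \<inter> forced s = {}" using *(4) down by blast
  then have "A \<times> B \<inter> (prc s \<union> sqs s) = {}" using forced_base by blast
  then show "swappable A B"
    using * assms(2,3,5) by (intro swappable_of_unforced[of A B s]) auto
qed

lemma ex_strictly_before:
  assumes S: "s \<in> step_sequences E sim" and "atomic s"
    and "\<alpha> \<in> occs s" "\<beta> \<in> occs s" "(\<alpha>, \<beta>) \<notin> forced s"
  shows "\<exists>u\<in>class_of s. (\<beta>, \<alpha>) \<in> before u"
proof -
  \<comment> \<open>The principal down-set of \<open>\<beta>\<close> contains the whole step of
    \<open>\<beta>\<close> but not \<open>\<alpha>\<close>.\<close>
  define D where "D = {x. (x, \<beta>) \<in> forced s}"
  have down: "(forced s)\<inverse> `` D \<subseteq> D"
    using forced_trans[of _ _ s \<beta>] unfolding D_def by blast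
  have "realizes s ([] @ occ_seq s @ [])"
    using class_of_refl[OF S] by (auto simp: realizes_def)
  from realizes_down_set_first[OF this assms(2) order.refl disjoint_steps_occ_list _ down]
  obtain u where u: "u \<in> class_of s"
    "occ_seq u = filter (\<lambda>A. A \<subseteq> D) (occ_seq s) @ filter (\<lambda>A. \<not> A \<subseteq> D) (occ_seq s)"
    by (auto simp: realizes_def before_eq)
  obtain A B where AB: "A \<in> set (occ_seq s)" "\<alpha> \<in> A" "B \<in> set (occ_seq s)" "\<beta> \<in> B"
    using assms(3,4) by (auto simp: occs_eq_Union)
  have "\<not> A \<subseteq> D" using AB(2) assms(5) by (auto simp: D_def)
  moreover have "B \<subseteq> D"
    using atomic_forced[OF assms(2) AB(3) _ AB(4)] unfolding D_def by blast
  ultimately have "(\<beta>, \<alpha>) \<in> before u"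
    using AB by (auto simp: before_eq u(2) list_before_append)
  then show ?thesis using u(1) by blast
qed

text \<open>Let \<open>L\<close> be the part below \<open>I\<close> but outside it; convexity makes
  \<open>L\<close> a down-set, as is \<open>L \<union> I\<close>. Executing
  \<open>L \<union> I\<close> first, and \<open>L\<close> first within it, leaves a contiguous block
  \<open>M\<close> made up of \<open>I\<close>. Filtering keeps the order of \<open>s\<close>, so
  \<open>M\<close> can be fused.\<close>

lemma ex_same_step:
  assumes S: "s \<in> step_sequences E sim" and atomic: "atomic s"
    and I: "I \<noteq> {}" "I \<subseteq> occs s"
    and convex: "\<And>x y z. x \<in> I \<Longrightarrow> z \<in> I \<Longrightarrow> (x, y) \<in> forced s \<Longrightarrow> (y, z) \<in> forced s \<Longrightarrow> y \<in> I"
    and ser: "\<And>x y. x \<in> I \<Longrightarrow> y \<in> I \<Longrightarrow> (x, y) \<in> before s \<Longrightarrow> (x, y) \<in> lser"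
  shows "\<exists>u\<in>class_of s. \<forall>x\<in>I. \<forall>y\<in>I. pos u x = pos u y"
proof -
  define L where "L = {x. x \<notin> I \<and> (\<exists>i\<in>I. (x, i) \<in> forced s)}"
  have down_LI: "(forced s)\<inverse> `` (L \<union> I) \<subseteq> L \<union> I"
    using forced_trans unfolding L_def by blast
  have down_L: "(forced s)\<inverse> `` L \<subseteq> L"
  proof
    fix x assume "x \<in> (forced s)\<inverse> `` L"
    then obtain y i where xy: "(x, y) \<in> forced s"
      and i: "y \<notin> I" "i \<in> I" "(y, i) \<in> forced s"
      by (auto simp: L_def)
    then show "x \<in> L"
      using forced_trans[OF xy i(3)] convex[OF _ i(2) xy i(3)] by (auto simp: L_def)
  qed
  define T where "T = filter (\<lambda>A. A \<subseteq> L \<union> I) (occ_seq s)"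
  define U where "U = filter (\<lambda>A. \<not> A \<subseteq> L \<union> I) (occ_seq s)"
  define M where "M = filter (\<lambda>A. \<not> A \<subseteq> L) T"
  have "realizes s ([] @ occ_seq s @ [])"
    using class_of_refl[OF S] by (auto simp: realizes_def)
  from realizes_down_set_first[OF this atomic order.refl disjoint_steps_occ_list _ down_LI]
  have 1: "realizes s ([] @ T @ U)"
    by (simp add: before_eq T_def U_def)
  have T: "set T \<subseteq> set (occ_seq s)" "disjoint_steps T" "list_before T \<subseteq> before s"
    unfolding T_def before_eq
    by (auto simp: disjoint_steps_filter disjoint_steps_occ_list dest: subsetD[OF list_before_filter])
  from realizes_down_set_first[OF 1 atomic T down_L]
  have 2: "realizes s (filter (\<lambda>A. A \<subseteq> L) T @ M @ U)" by (simp add: M_def)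
  have M_set: "A \<subseteq> I" if "A \<in> set M" for A
  proof -
    have A: "A \<in> set (occ_seq s)" "A \<subseteq> L \<union> I" "\<not> A \<subseteq> L"
      using that by (auto simp: M_def T_def)
    then obtain i where "i \<in> A" "i \<in> I" by blast
    moreover have "(x, i) \<in> forced s" "(i, x) \<in> forced s" if "x \<in> A" for x
      using atomic_forced[OF atomic A(1)] that \<open>i \<in> A\<close> by blast+
    \<comment> \<open>Every \<open>x\<close> of the step lies on a forced cycle through
      \<open>i\<close>, so convexity with both ends equal to \<open>i\<close> puts it into
      \<open>I\<close>.\<close>
    ultimately show ?thesis using convex[of i i] by blast
  qed
  have I_sub: "I \<subseteq> \<Union> (set M)"
  proof
    fix i assume i: "i \<in> I"
    then obtain A where A: "A \<in> set (occ_seq s)" "i \<in> A"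
      using I(2) by (auto simp: occs_eq_Union)
    have "(x, i) \<in> forced s" if "x \<in> A" for x
      using atomic_forced[OF atomic A(1) that A(2)] .
    then have "A \<subseteq> L \<union> I" using i unfolding L_def by blast
    moreover have "\<not> A \<subseteq> L" using A(2) i by (auto simp: L_def)
    ultimately show "i \<in> \<Union> (set M)" using A by (auto simp: M_def T_def)
  qed
  have "list_before M \<subseteq> before s"
    using T(3) list_before_filter unfolding M_def by blast
  moreover have "list_before M \<subseteq> I \<times> I"
    using list_before_subset[of M] M_set by blast
  ultimately have "list_before M \<subseteq> lser" using ser by blast
  moreover have "M \<noteq> []" using I(1) I_sub by auto
  ultimately have "realizes s (filter (\<lambda>A. A \<subseteq> L) T @ [\<Union> (set M)] @ U)"
    using 2 by (intro realizes_fuse_list)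
  then obtain u where u: "u \<in> class_of s" "\<Union> (set M) \<in> set (occ_seq u)"
    by (auto simp: realizes_def)
  have "pos u x = pos u y" if "x \<in> I" "y \<in> I" for x y
    using same_step_iff[OF u(2), of y x] that I_sub I(2) invariant_class_of(1)[OF u(1)] by blast
  then show ?thesis using u(1) by blast
qed

text \<open>Completeness of the first relation in contrapositive form. The assumption on positions
  loses no generality, since that relation is symmetric.\<close>

lemma ex_same_pos_le:
  assumes S: "s \<in> step_sequences E sim" and atomic: "atomic s"
    and occs: "\<alpha> \<in> occs s" "\<beta> \<in> occs s" "pos s \<alpha> \<le> pos s \<beta>" "(\<alpha>, \<beta>) \<notin> linl"
    and unforced: "(\<alpha>, \<beta>) \<notin> forced s O ((prc s \<union> occ_inl inl s) \<inter> forced s) O forced s"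
    and np: "(\<alpha>, \<beta>) \<notin> prc s"
  shows "\<exists>u\<in>class_of s. pos u \<alpha> = pos u \<beta>"
proof (cases "pos s \<alpha> = pos s \<beta>")
  case True
  then show ?thesis using class_of_refl[OF S] by blast
next
  case False
  then have bef: "(\<alpha>, \<beta>) \<in> before s" using occs by (simp add: before_def)
  then have ab_ser: "(\<alpha>, \<beta>) \<in> lser" using np occs(4) by (simp add: prc_iff)
  show ?thesis
  proof (cases "(\<alpha>, \<beta>) \<in> forced s")
    case True
    define I where "I = {x. (\<alpha>, x) \<in> forced s \<and> (x, \<beta>) \<in> forced s}"
    \<comment> \<open>Such a pair would be a middle factor of the composition in
      \<open>unforced\<close>. Hence chains inside the interval use \<sqsubset> only, which turns
      \<open>forced\<close> into \<open>sq_star\<close> as clause (iii) requires.\<close>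
    have no_prc: "(x, y) \<notin> prc s" if "(\<alpha>, x) \<in> forced s" "(y, \<beta>) \<in> forced s" for x y
      using that unforced forced_base(1) by blast
    have "(x, y) \<in> (prc s \<union> sqs s)\<^sup>+ \<Longrightarrow> (y, \<beta>) \<in> forced s \<Longrightarrow> (x, y) \<in> (sqs s)\<^sup>+"
      if x: "(\<alpha>, x) \<in> forced s" for x y
    proof (induction rule: trancl_induct)
      case (base y)
      then show ?case using no_prc[OF x] by blast
    next
      case (step y z)
      then have "(y, z) \<in> forced s" using forced_base by blast
      then have "(y, \<beta>) \<in> forced s" using step.prems by (rule forced_trans)
      then have "(x, y) \<in> (sqs s)\<^sup>+" by (rule step.IH)
      moreover have "(x, y) \<in> forced s"
        using step.hyps(1) by (simp add: forced_def star_on_def)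
      then have "(\<alpha>, y) \<in> forced s" by (rule forced_trans[OF x])
      then have "(y, z) \<in> sqs s" using step.hyps(2) step.prems no_prc by blast
      ultimately show ?case by (rule trancl_into_trancl)
    qed
    then have sq: "(x, y) \<in> sq_star s"
      if "(x, y) \<in> forced s" "(\<alpha>, x) \<in> forced s" "(y, \<beta>) \<in> forced s" for x y
      using that unfolding forced_def star_on_def by blast
    have "\<exists>u\<in>class_of s. \<forall>x\<in>I. \<forall>y\<in>I. pos u x = pos u y"
    proof (rule ex_same_step[OF S atomic])
      show "I \<noteq> {}" using True forced_refl[OF occs(1)] unfolding I_def by blast
      show "I \<subseteq> occs s" using forced_pos_le(1) unfolding I_def by blast
      show "y \<in> I" if "x \<in> I" "z \<in> I" "(x, y) \<in> forced s" "(y, z) \<in> forced s" for x y z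
        using that(1,2) forced_trans[OF _ that(3)] forced_trans[OF that(4)] unfolding I_def by blast
      show "(x, y) \<in> lser" if "x \<in> I" "y \<in> I" "(x, y) \<in> before s" for x y
      proof (rule ccontr)
        \<comment> \<open>Otherwise \<open>x\<close> and \<open>y\<close> are witnesses of clause
          (iii) for \<open>\<alpha>\<close> and \<open>\<beta>\<close>.\<close>
        assume n: "(x, y) \<notin> lser"
        have "(\<alpha>, x) \<in> sq_star s" "(x, \<beta>) \<in> sq_star s" "(\<alpha>, y) \<in> sq_star s" "(y, \<beta>) \<in> sq_star s"
          using that(1,2) sq forced_refl occs(1,2) unfolding I_def by blast+
        moreover have "x \<in> occs s" "y \<in> occs s" using that(3) by (auto simp: before_def)
        ultimately have "(\<alpha>, \<beta>) \<in> prc s"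
          using ab_ser bef n that(3) unfolding prc_iff by blast
        then show False using np by blast
      qed
    qed
    moreover have "\<alpha> \<in> I" "\<beta> \<in> I" using True forced_refl occs(1,2) by (auto simp: I_def)
    ultimately show ?thesis by blast
  next
    case nf: False
    obtain A B where AB: "A \<in> set (occ_seq s)" "\<alpha> \<in> A" "B \<in> set (occ_seq s)" "\<beta> \<in> B"
      using occs(1,2) by (auto simp: occs_eq_Union)
    have AB_occs: "A \<subseteq> occs s" "B \<subseteq> occs s" using AB by (auto simp: occs_eq_Union)
    have A: "x \<in> A \<longleftrightarrow> pos s x = pos s \<alpha>" and B: "x \<in> B \<longleftrightarrow> pos s x = pos s \<beta>"
      if "x \<in> occs s" for x
      using same_step_iff[OF AB(1,2) that] same_step_iff[OF AB(3,4) that] by auto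
    have A_forced: "(\<alpha>, x) \<in> forced s" if "x \<in> A" for x
      using atomic_forced[OF atomic AB(1,2) that] .
    have B_forced: "(x, \<beta>) \<in> forced s" if "x \<in> B" for x
      using atomic_forced[OF atomic AB(3) that AB(4)] .
    have AB_unforced: "(x, y) \<notin> forced s" if "x \<in> A" "y \<in> B" for x y
      using forced_trans[OF A_forced[OF that(1)] forced_trans[OF _ B_forced[OF that(2)]]] nf by blast
    have "A \<times> B \<subseteq> before s"
    proof (rule subrelI)
      fix x y assume "(x, y) \<in> A \<times> B"
      moreover from this have "x \<in> occs s" "y \<in> occs s" using AB_occs by blast+
      ultimately show "(x, y) \<in> before s"
        using A[of x] B[of y] False occs(3) by (simp add: before_def)
    qed
    moreover have "A \<times> B \<inter> (prc s \<union> sqs s) = {}"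
      using AB_unforced forced_base by blast
    ultimately have "swappable A B" using atomic AB by (intro swappable_of_unforced)
    \<comment> \<open>The alternative with \<open>linl\<close> is ruled out by the pair of
      \<open>\<alpha>\<close> and \<open>\<beta>\<close> itself.\<close>
    then have ser_AB: "A \<times> B \<subseteq> lser" using AB occs(4) by (auto simp: swappable_def)
    have "\<exists>u\<in>class_of s. \<forall>x\<in>A \<union> B. \<forall>y\<in>A \<union> B. pos u x = pos u y"
    proof (rule ex_same_step[OF S atomic])
      show "A \<union> B \<noteq> {}" using AB by blast
      show "A \<union> B \<subseteq> occs s" using AB_occs by blast
      show "y \<in> A \<union> B"
        if "x \<in> A \<union> B" "z \<in> A \<union> B" "(x, y) \<in> forced s" "(y, z) \<in> forced s" for x y z
      proof -
        note xy = forced_pos_le[OF that(3)] and yz = forced_pos_le[OF that(4)]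
        \<comment> \<open>Nothing is forced from \<open>A\<close> to \<open>B\<close>, and positions
          forbid the direction from \<open>B\<close> to \<open>A\<close>. So \<open>x\<close> and
          \<open>z\<close> share a step, and \<open>y\<close> is squeezed into it by its
          position.\<close>
        have "x \<in> B \<or> z \<in> A"
          using that(1,2) AB_unforced[of x z] forced_trans[OF that(3,4)] by blast
        then show ?thesis
          using that(1,2) xy yz A[of x] A[of y] A[of z] B[of x] B[of y] B[of z] False occs(3) by auto
      qed
      show "(x, y) \<in> lser" if "x \<in> A \<union> B" "y \<in> A \<union> B" "(x, y) \<in> before s" for x y
      proof -
        have "x \<in> A \<and> y \<in> B"
          using that A[of x] A[of y] B[of x] B[of y] occs(3) by (auto simp: before_def)
        then show ?thesis using ser_AB by blast
      qed
    qed
    then show ?thesis using AB by blast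
  qed
qed

text \<open>Distinct occurrences in one step have labels in \<open>sim\<close>, which is disjoint
  from \<open>inl\<close>.\<close>

lemma occ_inl_subset:
  assumes "s \<in> step_sequences E sim"
  shows "occ_inl inl s \<subseteq> rel_sym (before s)"
proof (rule subrelI)
  fix \<alpha> \<beta> assume "(\<alpha>, \<beta>) \<in> occ_inl inl s"
  then have *: "\<alpha> \<in> occs s" "\<beta> \<in> occs s" "(fst \<alpha>, fst \<beta>) \<in> inl" by (auto simp: occ_inl_def)
  have "pos s \<alpha> \<noteq> pos s \<beta>"
  proof
    assume eq: "pos s \<alpha> = pos s \<beta>"
    obtain A where A: "A \<in> set (occ_seq s)" "\<alpha> \<in> A" using *(1) by (auto simp: occs_eq_Union)
    then have "\<beta> \<in> A" using same_step_iff[OF A *(2)] eq by simp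
    moreover have "\<alpha> \<noteq> \<beta>" using *(3) not_inl_refl by auto
    ultimately have "(fst \<alpha>, fst \<beta>) \<in> sim" using same_step_sim[OF assms A] by blast
    then show False using *(3) not_sim_inl by blast
  qed
  then show "(\<alpha>, \<beta>) \<in> rel_sym (before s)"
    using * by (auto simp: rel_sym_def before_def)
qed

section \<open>Equality of the two structures\<close>

lemma seq_structure_atomic:
  assumes S: "s \<in> step_sequences E sim" and atomic: "atomic s"
  shows "seq_structure ser inl s = trace_structure E sim ser inl s"
proof -
  let ?R = "prc s \<union> occ_inl inl s"
  let ?F = "forced s O (?R \<inter> forced s) O forced s"
  have occs: "occs u = occs s" and prc: "prc s \<subseteq> before u"
    and inl: "occ_inl inl s \<subseteq> rel_sym (before u)" and frc: "forced u = forced s"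
    if u: "u \<in> class_of s" for u
  proof -
    note inv = invariant_class_of[OF u]
    show "occs u = occs s" by (rule inv(1))
    show "prc s \<subseteq> before u" using prc_before[of u] inv(3) by simp
    show "occ_inl inl s \<subseteq> rel_sym (before u)"
      using occ_inl_subset[OF class_of_step_seqs[OF u]] inv(1) by (simp add: occ_inl_def)
    show "forced u = forced s" by (simp add: forced_def inv)
  qed
  have self: "s \<in> class_of s" using S by (rule class_of_refl)
  \<comment> \<open>The middle pair is at different positions in every \<open>u\<close>;
    \<open>forced\<close> fixes its direction, and the outer factors do not lead back.\<close>
  have F_before: "(\<alpha>, \<beta>) \<in> before u" if u: "u \<in> class_of s" and F: "(\<alpha>, \<beta>) \<in> ?F" for u \<alpha> \<beta>
  proof -
    obtain x y where xy: "(\<alpha>, x) \<in> forced u" "(x, y) \<in> ?R" "(x, y) \<in> forced u" "(y, \<beta>) \<in> forced u"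
      using F unfolding frc[OF u] by blast
    note le = forced_pos_le[OF xy(1)] forced_pos_le[OF xy(3)] forced_pos_le[OF xy(4)]
    have "(x, y) \<in> rel_sym (before u)"
      using xy(2) prc[OF u] inl[OF u] by (auto simp: rel_sym_def)
    then have "(x, y) \<in> before u" using le by (auto simp: rel_sym_def before_def)
    then show ?thesis using le by (auto simp: before_def)
  qed
  have "rel_sym ?F \<union> ?R = (\<Inter>u\<in>class_of s. rel_sym (before u))"
  proof (rule equalityI; rule subrelI)
    fix \<alpha> \<beta> assume *: "(\<alpha>, \<beta>) \<in> rel_sym ?F \<union> ?R"
    have "(\<alpha>, \<beta>) \<in> rel_sym (before u)" if "u \<in> class_of s" for u
      using * F_before[OF that] prc[OF that] inl[OF that] unfolding rel_sym_def by blast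
    then show "(\<alpha>, \<beta>) \<in> (\<Inter>u\<in>class_of s. rel_sym (before u))" by blast
  next
    fix \<alpha> \<beta> assume "(\<alpha>, \<beta>) \<in> (\<Inter>u\<in>class_of s. rel_sym (before u))"
    then have *: "(\<alpha>, \<beta>) \<in> rel_sym (before u)" if "u \<in> class_of s" for u using that by blast
    have ab: "\<alpha> \<in> occs s" "\<beta> \<in> occs s" using *[OF self] by (auto simp: rel_sym_def before_def)
    have ne: "\<not> (\<exists>u\<in>class_of s. pos u \<alpha> = pos u \<beta>)" "\<not> (\<exists>u\<in>class_of s. pos u \<beta> = pos u \<alpha>)"
      using * by (force simp: rel_sym_def before_def)+
    show "(\<alpha>, \<beta>) \<in> rel_sym ?F \<union> ?R"
    proof (rule ccontr)
      assume neg: "(\<alpha>, \<beta>) \<notin> rel_sym ?F \<union> ?R"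
      have n: "(\<alpha>, \<beta>) \<notin> ?F" "(\<beta>, \<alpha>) \<notin> ?F" using neg unfolding rel_sym_def by blast+
      have prc_F: "p \<in> ?F" if "p \<in> prc s" for p
      proof -
        obtain x y where p: "p = (x, y)" by (cases p)
        then have xy: "(x, y) \<in> prc s" "(x, y) \<in> forced s" using that forced_base by simp_all
        then have "(x, x) \<in> forced s" "(y, y) \<in> forced s"
          using forced_pos_le[OF xy(2)] forced_refl by simp_all
        then show ?thesis using xy unfolding p by blast
      qed
      have "(\<alpha>, \<beta>) \<notin> linl" "(\<beta>, \<alpha>) \<notin> linl"
        using neg ab inl_symD by (auto simp: occ_inl_def)
      then show False
        using ex_same_pos_le[OF S atomic ab] ex_same_pos_le[OF S atomic ab(2,1)] ne n prc_F
        by (meson nle_le)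
    qed
  qed
  moreover have "forced s - Id_on (occs s) = (\<Inter>u\<in>class_of s. not_after u)"
  proof (rule equalityI; rule subrelI)
    fix \<alpha> \<beta> assume *: "(\<alpha>, \<beta>) \<in> forced s - Id_on (occs s)"
    have "(\<alpha>, \<beta>) \<in> not_after u" if "u \<in> class_of s" for u
      using * forced_pos_le[of \<alpha> \<beta> u] occs[OF that] unfolding frc[OF that]
      by (auto simp: not_after_def)
    then show "(\<alpha>, \<beta>) \<in> (\<Inter>u\<in>class_of s. not_after u)" by blast
  next
    fix \<alpha> \<beta> assume "(\<alpha>, \<beta>) \<in> (\<Inter>u\<in>class_of s. not_after u)"
    then have *: "(\<alpha>, \<beta>) \<in> not_after u" if "u \<in> class_of s" for u using that by blast
    have ab: "\<alpha> \<in> occs s" "\<beta> \<in> occs s" "\<alpha> \<noteq> \<beta>" using *[OF self] by (auto simp: not_after_def)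
    have "\<not> (\<exists>u\<in>class_of s. (\<beta>, \<alpha>) \<in> before u)"
      using * by (auto simp: not_after_eq)
    then show "(\<alpha>, \<beta>) \<in> forced s - Id_on (occs s)"
      using ex_strictly_before[OF S atomic ab(1,2)] ab by (auto simp: Id_on_iff)
  qed
  ultimately show ?thesis by (simp add: seq_structure_eq trace_structure_def)
qed

text \<open>Both structures depend on the class only, so \<open>s\<close> may be replaced by an
  atomic member.\<close>

lemma seq_structure_eq_trace_structure:
  assumes "s \<in> step_sequences E sim"
  shows "seq_structure ser inl s = trace_structure E sim ser inl s"
proof -
  obtain u where u: "u \<in> class_of s" "atomic u" using ex_atomic[OF assms] .
  note inv = invariant_class_of[OF u(1)]
  have "seq_structure ser inl s = seq_structure ser inl u"
    by (simp add: seq_structure_eq forced_def occ_inl_def inv)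
  also have "\<dots> = trace_structure E sim ser inl u"
    using class_of_step_seqs[OF u(1)] u(2) by (rule seq_structure_atomic)
  also have "\<dots> = trace_structure E sim ser inl s"
    by (simp add: trace_structure_def inv class_of_eq[OF u(1)])
  finally show ?thesis .
qed

end

theorem theorem11p2:
  fixes E :: "'a set" and sim ser inl :: "'a rel" and s :: "'a set list"
  assumes "gcomtrace_alphabet E sim ser inl"
    and "s \<in> step_sequences E sim"
  shows "seq_structure ser inl s = trace_structure E sim ser inl s"
proof -
  interpret gcomtrace_alph E sim ser inl using assms(1) by unfold_locales
  show ?thesis using assms(2) by (rule seq_structure_eq_trace_structure)
qed

end
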